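(* Let $J$ be a finite subset of $\mathbb{N}=\{1,2,\ldots\}$ and $\{\zeta_i\}_{i\in J}$ a collection of $\mathbb{Z}_+$-valued random variables with $\mathbb{E}(\zeta_i^3)<\infty$. Suppose for each $i\in J$ there are sets $i\in A_i\subseteq B_i\subseteq J$ such that $\zeta_i$ is independent of $\{\zeta_j\}_{j\in A_i^c}$ and $\{\zeta_j\}_{j\in A_i}$ is independent of $\{\zeta_j\}_{j\in B_i^c}$. Let $V=\sum_{i\in J}\zeta_i$. Let $r>1$, $p\in(0,1)$, $q=1-p$, and let $\mathscr{A}$ and $g_z$ be as in the context. Define $U_J$ as follows. Case (a): if $rq/p=\mathbb{E}(V)$, $$U_J=\sum_{i\in J}\Big[p\,\mathbb{E}(\zeta_i)\mathbb{E}(\zeta_{A_i})+q\,\mathbb{E}(\zeta_i\zeta_{A_i})+\mathbb{E}(\zeta_i(\zeta_{A_i}-1))\Big].$$ Case (b): if $rq/p=\mathbb{E}(V)$ and $rq/p^2=\mathrm{Var}(V)$, $$\begin{aligned}U_J={}&p\sum_{i\in J}\mathbb{E}(\zeta_i)\,\mathbb{E}\big[\zeta_{A_i}(2\zeta_{B_i}-\zeta_{A_i}-1)\mathscr{D}(V\mid\zeta_{A_i},\zeta_{B_i})\big]+q\sum_{i\in J}\mathbb{E}\big[\zeta_i\zeta_{A_i}(2\zeta_{B_i}-\zeta_{A_i}-1)\mathscr{D}(V\mid\zeta_i,\zeta_{A_i},\zeta_{B_i})\big]\\&+\sum_{i\in J}\big|p\,\mathbb{E}(\zeta_i)\mathbb{E}(\zeta_{A_i})+q\,\mathbb{E}(\zeta_i\zeta_{A_i})-\mathbb{E}(\zeta_i(\zeta_{A_i}-1))\big|\,\mathbb{E}\big[\zeta_{B_i}\mathscr{D}(V\mid\zeta_{B_i})\big]\\&+\sum_{i\in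 J}\mathbb{E}\big[\zeta_i(\zeta_{A_i}-1)(2\zeta_{B_i}-\zeta_{A_i}-2)\mathscr{D}(V\mid\zeta_i,\zeta_{A_i},\zeta_{B_i})\big].\end{aligned}$$ Then, in each case, (1) (uniform bound) $\sup_{z\ge0}|\mathbb{E}[\mathscr{A}g_z(V)]|\le\left(2p^{-(r+1)}-p^{-1}\right)U_J$; (2) (non-uniform bound) $|\mathbb{E}[\mathscr{A}g_z(V)]|\le\vartheta_{r,p,z}\,U_J$ for all $z>1$, where $\vartheta_{r,p,z}=\frac{r+1}{z}\left((1+q^{-1})p^{-(r+2)}-p^{-2}\right)$.
   Context: $\mathbb{Z}_+=\{0,1,2,\ldots\}$, $x^+=\max\{x,0\}$, $A^c=J\setminus A$. For $A\subseteq J$, $\zeta_A=\sum_{i\in A}\zeta_i$. $\mathrm{N}_{r,p}$ is negative binomial with $\mathbb{P}(\mathrm{N}_{r,p}=k)=\binom{r+k-1}{k}p^rq^k$, $k\in\mathbb{Z}_+$ (mean $rq/p$, variance $rq/p^2$). The Stein operator is $\mathscr{A}g(k)=q(r+k)g(k+1)-kg(k)$. For $z\ge0$, $g_z(0)=0$ and for $k\ge1$, $g_z(k)=-\sum_{j\ge k}\frac{r(r+1)\cdots(r+j-1)}{r(r+1)\cdots(r+k-1)}\frac{(k-1)!}{j!}q^{j-k}\big[(j-z)^+-\mathbb{E}[(\mathrm{N}_{r,p}-z)^+]\big]$; it satisfies $\mathscr{A}g_z(k)=(k-z)^+-\mathbb{E}[(\mathrm{N}_{r,p}-z)^+]$,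 so $\mathbb{E}[\mathscr{A}g_z(V)]=\mathbb{E}[(V-z)^+]-\mathbb{E}[(\mathrm{N}_{r,p}-z)^+]$. For a random variable $W$, $\mathscr{D}(W)=2d_{TV}(W,W+1)$ where $d_{TV}$ is total variation distance; $\mathscr{D}(V\mid X)$ denotes the same quantity computed for the conditional distribution of $V$ given $X$, i.e. $2d_{TV}(\mathcal{L}(V\mid X),\mathcal{L}(V+1\mid X))$. *)

theory Defs
  imports "HOL-Probability.Probability"
begin

definition nb_pmf :: "real \<Rightarrow> real \<Rightarrow> nat \<Rightarrow> real" where
  "nb_pmf r p k = ((r + real k - 1) gchoose k) * p powr r * (1 - p) ^ k"

definition nb_excess :: "real \<Rightarrow> real \<Rightarrow> real \<Rightarrow> real" where
  "nb_excess r p z = (\<Sum>k. nb_pmf r p k * max (real k - z) 0)"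

definition stein_op :: "real \<Rightarrow> real \<Rightarrow> (nat \<Rightarrow> real) \<Rightarrow> nat \<Rightarrow> real" where
  "stein_op r p g k = (1 - p) * (r + real k) * g (Suc k) - real k * g k"

text \<open>The Stein solution g_z (summation index j = k + n).\<close>
definition g_sol :: "real \<Rightarrow> real \<Rightarrow> real \<Rightarrow> nat \<Rightarrow> real" where
  "g_sol r p z k = (if k = 0 then 0 else
     - (\<Sum>n. pochhammer r (k + n) / pochhammer r k * fact (k - 1) / fact (k + n)
            * (1 - p) ^ n * (max (real (k + n) - z) 0 - nb_excess r p z)))"

text \<open>D(V | X)(w) = 2 d_TV(L(V | X = X w), L(V + 1 | X = X w)), for nat-valued V
  and discrete X:  sum over k of |P(V=k | X=x) - P(V+1=k | X=x)|.\<close>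
definition shiftD :: "'a measure \<Rightarrow> ('a \<Rightarrow> nat) \<Rightarrow> ('a \<Rightarrow> 'b) \<Rightarrow> 'a \<Rightarrow> real" where
  "shiftD M V X w =
     (\<Sum>k. \<bar>measure M {v \<in> space M. V v = k \<and> X v = X w}
           - (if k = 0 then 0 else measure M {v \<in> space M. V v = k - 1 \<and> X v = X w})\<bar>)
     / measure M {v \<in> space M. X v = X w}"

definition zsum :: "(nat \<Rightarrow> 'a \<Rightarrow> nat) \<Rightarrow> nat set \<Rightarrow> 'a \<Rightarrow> nat" where
  "zsum \<zeta> A w = (\<Sum>j\<in>A. \<zeta> j w)"

end

theory Submission
  imports Defs
begin

text \<open>The Stein solution satisfies \<open>- 1 / p \<le> g\<^sub>z \<le> 0\<close>: a nondecreasing test function has a nonpositive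
  solution, the identity has the constant solution \<open>- 1 / p\<close>, and both \<open>(j - z)\<^sup>+\<close> and
  \<open>j - (j - z)\<^sup>+\<close> are nondecreasing. So increments of \<open>g\<^sub>z\<close> are at most \<open>1 / p\<close> in absolute value. For the
  bound decaying in \<open>z\<close>: up to \<open>\<lfloor>z\<rfloor> + 1\<close> the solution is \<open>E (N - z)\<^sup>+\<close> times a monotone ratio of head sums,
  hence itself small; beyond \<open>z\<close> it is \<open>- 1 / p + E (z - N)\<^sup>+ R k\<close> with a ratio \<open>R\<close> of tail sums
  whose increments are controlled by its first-order recursion.

  The Stein expectation is expanded by local dependence around \<open>V - \<zeta>\<^bsub>A i\<^esub>\<close>, which gives case (a). Under
  variance matching the first-order coefficients sum to zero, so only unit shifts of increments of
  \<open>g\<^sub>z\<close> remain. Given \<open>X\<close>, a unit shift of \<open>V\<close> inside a function bounded by \<open>K\<close> costs at most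
  \<open>K \<D>(V | X)\<close>, by summation by parts.\<close>

section \<open>Negative binomial weights\<close>

lemma nb_pmf_pochhammer:
  "nb_pmf r p k = pochhammer r k / fact k * p powr r * (1 - p) ^ k"
  by (simp add: nb_pmf_def gbinomial_pochhammer' algebra_simps)

text \<open>Newton's binomial series for \<open>(1 + x) powr (- r)\<close> at
  \<open>x = - (1 - p)\<close> has sum \<open>p powr (- r)\<close>, which the factor
  \<open>p powr r\<close> cancels.\<close>

lemma nb_pmf_sums:
  assumes "0 < p" "p < 1"
  shows "nb_pmf r p sums 1"
proof -
  have "(\<lambda>k. ((- r) gchoose k) * (- (1 - p)) ^ k) sums (1 + - (1 - p)) powr (- r)"
    using assms by (intro gen_binomial_real) auto
  moreover have "((- r) gchoose k) * (- (1 - p)) ^ k = ((r + real k - 1) gchoose k) * (1 - p) ^ k" for k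
  proof -
    have "(- 1) ^ k * (- (1 - p)) ^ k = (1 - p) ^ k"
      by (simp flip: power_mult_distrib)
    then show ?thesis
      by (metis (no_types, lifting) gbinomial_minus mult.assoc mult.commute)
  qed
  ultimately have "(\<lambda>k. ((r + real k - 1) gchoose k) * (1 - p) ^ k) sums (p powr (- r))"
    by simp
  from sums_mult[OF this, of "p powr r"] assms show ?thesis
    by (simp add: nb_pmf_def [abs_def] powr_minus mult_ac)
qed

text \<open>Size biasing turns parameter \<open>r\<close> into \<open>r + 1\<close>, so the mean
  follows from total mass one alone.\<close>

lemma nb_pmf_size_bias:
  assumes "0 < p"
  shows "real (Suc k) * nb_pmf r p (Suc k) = r * (1 - p) / p * nb_pmf (r + 1) p k"
proof -
  have "pochhammer r (Suc k) = r * pochhammer (r + 1) k"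
    by (simp add: pochhammer_rec)
  then show ?thesis
    using assms by (simp add: nb_pmf_pochhammer powr_add divide_simps del: of_nat_Suc pochhammer_Suc)
qed

text \<open>Detailed balance between the two coefficients of \<open>stein_op\<close>. The
  telescoping and ratio arguments below rest on it.\<close>

lemma nb_pmf_Suc:
  "real (Suc k) * nb_pmf r p (Suc k) = (1 - p) * (r + real k) * nb_pmf r p k"
  by (simp add: nb_pmf_pochhammer pochhammer_Suc divide_simps del: of_nat_Suc)

lemma nb_mean_sums:
  assumes "0 < p" "p < 1"
  shows "(\<lambda>k. real k * nb_pmf r p k) sums (r * (1 - p) / p)"
proof -
  have "(\<lambda>k. r * (1 - p) / p * nb_pmf (r + 1) p k) sums (r * (1 - p) / p * 1)"
    by (intro sums_mult nb_pmf_sums assms)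
  then have "(\<lambda>k. real (Suc k) * nb_pmf r p (Suc k)) sums (r * (1 - p) / p)"
    using assms by (simp only: nb_pmf_size_bias) simp
  then show ?thesis
    by (subst (asm) sums_Suc_iff) simp
qed

section \<open>The Stein solution\<close>

locale nb_params =
  fixes r p :: real
  assumes r_gt_1: "1 < r" and p_pos: "0 < p" and p_less_1: "p < 1"
begin

abbreviation q :: real where "q \<equiv> 1 - p"
abbreviation \<pi> :: "nat \<Rightarrow> real" where "\<pi> \<equiv> nb_pmf r p"

definition \<mu> :: real where "\<mu> = r * q / p"

text \<open>Stein solutions are \<open>g k = - tail_sum h k / (k \<pi> k)\<close>.\<close>
definition tail_sum :: "(nat \<Rightarrow> real) \<Rightarrow> nat \<Rightarrow> real" where
  "tail_sum h k = (\<Sum>n. \<pi> (k + n) * (h (k + n) - (\<Sum>j. \<pi> j * h j)))"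

lemma pi_pos: "0 < \<pi> k"
  using r_gt_1 p_pos p_less_1 by (simp add: nb_pmf_pochhammer pochhammer_pos)

lemma pi_sums: "\<pi> sums 1"
  using p_pos p_less_1 by (rule nb_pmf_sums)

lemma pi_summable: "summable \<pi>"
  using pi_sums by (rule sums_summable)

lemma pi_suminf: "suminf \<pi> = 1"
  using pi_sums by (rule sums_unique[symmetric])

lemma pi_mean_sums: "(\<lambda>k. \<pi> k * real k) sums \<mu>"
  using nb_mean_sums[OF p_pos p_less_1, of r] by (simp add: \<mu>_def mult.commute)

lemma tail_summable:
  fixes h :: "nat \<Rightarrow> real"
  assumes "summable (\<lambda>j. \<pi> j * h j)"
  shows "summable (\<lambda>n. \<pi> (k + n) * (h (k + n) - c))"
proof -
  have "summable (\<lambda>j. \<pi> j * (h j - c))"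
    using assms pi_summable by (auto simp: right_diff_distrib intro!: summable_diff summable_mult2)
  from summable_ignore_initial_segment[OF this, of k] show ?thesis
    by (simp add: add.commute)
qed

text \<open>The centred function has total weighted sum zero, so a tail is minus the complementary
  head.\<close>

lemma tail_sum_eq_head:
  assumes "summable (\<lambda>j. \<pi> j * h j)"
  shows "tail_sum h k = - (\<Sum>j<k. \<pi> j * (h j - (\<Sum>j. \<pi> j * h j)))"
proof -
  define c where "c = (\<Sum>j. \<pi> j * h j)"
  have s: "summable (\<lambda>j. \<pi> j * (h j - c))"
    using tail_summable[OF assms, of 0 c] by simp
  have "(\<Sum>j. \<pi> j * (h j - c)) = (\<Sum>j. \<pi> j * h j) - (\<Sum>j. \<pi> j * c)"
    using assms pi_summable by (simp add: right_diff_distrib suminf_diff summable_mult2)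
  also have "\<dots> = 0"
    using pi_suminf suminf_mult2[OF pi_summable, of c] by (simp add: c_def)
  finally have "0 = (\<Sum>n. \<pi> (n + k) * (h (n + k) - c)) + (\<Sum>j<k. \<pi> j * (h j - c))"
    using suminf_split_initial_segment[OF s, of k] by simp
  then show ?thesis
    by (simp add: tail_sum_def c_def add.commute)
qed

text \<open>If \<open>h k\<close> is at least the mean, every tail term is nonnegative. Otherwise
  every head term is nonpositive, and the sign is read off the head.\<close>

lemma tail_sum_nonneg:
  assumes "summable (\<lambda>j. \<pi> j * h j)" and "mono h"
  shows "0 \<le> tail_sum h k"
proof (cases "(\<Sum>j. \<pi> j * h j) \<le> h k")
  case True
  have "0 \<le> \<pi> (k + n) * (h (k + n) - (\<Sum>j. \<pi> j * h j))" for n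
    using True monoD[OF \<open>mono h\<close>, of k "k + n"] pi_pos[of "k + n"] by simp
  then show ?thesis
    unfolding tail_sum_def by (intro suminf_nonneg tail_summable assms)
next
  case False
  have "\<pi> j * (h j - (\<Sum>j. \<pi> j * h j)) \<le> 0" if "j < k" for j
    using False monoD[OF \<open>mono h\<close>, of j k] that pi_pos[of j]
    by (intro mult_nonneg_nonpos) auto
  then have "(\<Sum>j<k. \<pi> j * (h j - (\<Sum>j. \<pi> j * h j))) \<le> 0"
    by (intro sum_nonpos) auto
  then show ?thesis
    using tail_sum_eq_head[OF assms(1), of k] by simp
qed

lemma tail_sum_add:
  assumes "summable (\<lambda>j. \<pi> j * h j)" "summable (\<lambda>j. \<pi> j * h' j)"
  shows "tail_sum (\<lambda>j. h j + h' j) k = tail_sum h k + tail_sum h' k"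
proof -
  define a b where "a = (\<Sum>j. \<pi> j * h j)" and "b = (\<Sum>j. \<pi> j * h' j)"
  have "(\<Sum>j. \<pi> j * (h j + h' j)) = a + b"
    unfolding a_def b_def distrib_left by (rule suminf_add[OF assms, symmetric])
  then have "tail_sum (\<lambda>j. h j + h' j) k
      = (\<Sum>n. \<pi> (k + n) * (h (k + n) - a) + \<pi> (k + n) * (h' (k + n) - b))"
    by (simp add: tail_sum_def algebra_simps)
  also have "\<dots> = (\<Sum>n. \<pi> (k + n) * (h (k + n) - a)) + (\<Sum>n. \<pi> (k + n) * (h' (k + n) - b))"
    by (intro suminf_add[symmetric] tail_summable assms)
  finally show ?thesis
    by (simp add: tail_sum_def a_def b_def)
qed

text \<open>By detailed balance, \<open>\<pi> j * (j - \<mu>)\<close> is an increment of the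
  sequence \<open>- j * \<pi> j / p\<close>, which tends to zero because the mean series
  converges.\<close>

lemma tail_sum_id_sums: "(\<lambda>n. \<pi> (k + n) * (real (k + n) - \<mu>)) sums (real k * \<pi> k / p)"
proof -
  define T where "T n = - (real (k + n) * \<pi> (k + n) / p)" for n
  have "(\<lambda>n. real (n + k) * \<pi> (n + k)) \<longlonglongrightarrow> 0"
    using LIMSEQ_ignore_initial_segment[OF summable_LIMSEQ_zero[OF sums_summable[OF pi_mean_sums]], of k]
    by (simp add: mult.commute)
  then have "T \<longlonglongrightarrow> - (0 / p)"
    unfolding T_def by (intro tendsto_intros) (use p_pos in \<open>auto simp: add.commute\<close>)
  from telescope_sums[OF this] have "(\<lambda>n. T (Suc n) - T n) sums (real k * \<pi> k / p)"
    by (simp add: T_def)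
  moreover have "T (Suc n) - T n = \<pi> (k + n) * (real (k + n) - \<mu>)" for n
  proof -
    have "T (Suc n) - T n = (real (k + n) * \<pi> (k + n) - real (Suc (k + n)) * \<pi> (Suc (k + n))) / p"
      by (simp add: T_def diff_divide_distrib)
    also have "\<dots> = \<pi> (k + n) * (real (k + n) - \<mu>)"
      unfolding nb_pmf_Suc \<mu>_def using p_pos by (simp add: field_simps)
    finally show ?thesis .
  qed
  ultimately show ?thesis
    by simp
qed

lemma tail_sum_id: "tail_sum real k = real k * \<pi> k / p"
  using sums_unique[OF tail_sum_id_sums] sums_unique[OF pi_mean_sums] by (simp add: tail_sum_def)

lemma call_summable: "summable (\<lambda>j. \<pi> j * max (real j - z) 0)"
proof (rule summable_comparison_test')
  show "summable (\<lambda>j. \<pi> j * real j + \<pi> j * \<bar>z\<bar>)"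
    by (intro summable_add summable_mult2 pi_summable sums_summable[OF pi_mean_sums])
next
  fix j
  have "\<pi> j * max (real j - z) 0 \<le> \<pi> j * (real j + \<bar>z\<bar>)"
    using pi_pos[of j] by (intro mult_left_mono) auto
  then show "norm (\<pi> j * max (real j - z) 0) \<le> \<pi> j * real j + \<pi> j * \<bar>z\<bar>"
    using pi_pos[of j] by (simp add: distrib_left)
qed

lemma g_sol_eq:
  assumes "0 < k"
  shows "g_sol r p z k = - tail_sum (\<lambda>j. max (real j - z) 0) k / (real k * \<pi> k)"
proof -
  have *: "pochhammer r (k + n) / pochhammer r k * fact (k - 1) / fact (k + n) * (1 - p) ^ n
     = \<pi> (k + n) / (real k * \<pi> k)" for n
  proof -
    have "pochhammer r k > 0" "pochhammer r (k + n) > 0"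
      using r_gt_1 by (auto intro!: pochhammer_pos)
    moreover have "fact k = real k * fact (k - 1)"
      using assms by (simp add: fact_reduce)
    ultimately show ?thesis
      using p_pos p_less_1 assms by (simp add: nb_pmf_pochhammer power_add field_simps)
  qed
  have "(\<Sum>n. \<pi> (k + n) / (real k * \<pi> k) * (max (real (k + n) - z) 0 - nb_excess r p z))
     = tail_sum (\<lambda>j. max (real j - z) 0) k / (real k * \<pi> k)"
    using suminf_divide[OF tail_summable[OF call_summable[of z], of k "nb_excess r p z"]]
    by (simp add: tail_sum_def nb_excess_def)
  then show ?thesis
    using assms unfolding g_sol_def by (simp only: *) simp
qed

lemma g_sol_nonpos: "g_sol r p z k \<le> 0"
proof (cases "k = 0")
  case False
  have "0 \<le> tail_sum (\<lambda>j. max (real j - z) 0) k"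
    by (intro tail_sum_nonneg call_summable monoI) auto
  then show ?thesis
    using False pi_pos[of k] by (simp add: g_sol_eq)
qed (simp add: g_sol_def)

text \<open>The test function \<open>h j = j\<close> has constant solution \<open>- 1 / p\<close>, and \<open>j - (j - z)\<^sup>+\<close> is
  nondecreasing.\<close>
lemma g_sol_ge: "- 1 / p \<le> g_sol r p z k"
proof (cases "k = 0")
  case False
  define h where "h j = max (real j - z) 0" for j
  define h' where "h' j = real j - h j" for j
  have s: "summable (\<lambda>j. \<pi> j * h j)"
    unfolding h_def by (rule call_summable)
  have s': "summable (\<lambda>j. \<pi> j * h' j)"
    unfolding h'_def right_diff_distrib
    by (intro summable_diff s sums_summable[OF pi_mean_sums])
  have "(\<lambda>j. h j + h' j) = real"
    by (auto simp: h'_def)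
  then have "real k * \<pi> k / p = tail_sum h k + tail_sum h' k"
    using tail_sum_add[OF s s', of k] by (simp only: tail_sum_id)
  moreover have "0 \<le> tail_sum h' k"
    by (intro tail_sum_nonneg s' monoI) (auto simp: h'_def h_def)
  ultimately have "tail_sum h k \<le> real k * \<pi> k / p"
    by simp
  then have "tail_sum h k / (real k * \<pi> k) \<le> 1 / p"
    using False pi_pos[of k] by (simp add: field_simps)
  then show ?thesis
    using False by (simp add: g_sol_eq h_def[abs_def])
qed (use p_pos in \<open>simp add: g_sol_def\<close>)

section \<open>Increment bound independent of \<open>z\<close>\<close>

lemma abs_g_sol_diff_le: "\<bar>g_sol r p z (Suc k) - g_sol r p z k\<bar> \<le> 1 / p"
  using g_sol_nonpos[of z k] g_sol_ge[of z k] g_sol_nonpos[of z "Suc k"] g_sol_ge[of z "Suc k"]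
  by linarith

text \<open>Since \<open>1 / p\<close> is at most \<open>p powr (- (r + 1))\<close>, the increment
  bound \<open>1 / p\<close> already lies below this constant.\<close>

lemma g_sol_diff_uniform:
  "\<bar>g_sol r p z (Suc k) - g_sol r p z k\<bar> \<le> 2 * p powr (- (r + 1)) - 1 / p"
proof -
  have "p powr (- 1) \<le> p powr (- (r + 1))"
    using r_gt_1 p_pos p_less_1 by (intro powr_mono') auto
  then have "1 / p \<le> p powr (- (r + 1))"
    using p_pos by (simp add: powr_minus divide_inverse)
  then show ?thesis
    using abs_g_sol_diff_le[of z k] by linarith
qed

section \<open>Decay of the solution to the left of \<open>z\<close>\<close>

lemma pi_ratio_le: "\<pi> (m + 1 + n) * \<pi> 1 \<le> \<pi> (1 + n) * \<pi> (m + 1)"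
proof (induction n)
  case (Suc n)
  have step: "\<pi> (Suc j) = q * ((r + real j) / real (Suc j)) * \<pi> j" for j
    using nb_pmf_Suc[of j r p] by (simp add: field_simps)
  \<comment> \<open>The ratio \<open>(r + j) / (j + 1)\<close> decreases in \<open>j\<close> because
    \<open>r > 1\<close>, so the weights from \<open>m + 1\<close> on grow no faster than those from
    \<open>1\<close> on.\<close>
  have "(r + real (m + 1 + n)) / real (Suc (m + 1 + n)) \<le> (r + real (1 + n)) / real (Suc (1 + n))"
  proof -
    have "(r - 1) * real m \<ge> 0"
      using r_gt_1 by simp
    then show ?thesis
      by (simp add: divide_simps algebra_simps)
  qed
  then have "q * ((r + real (m + 1 + n)) / real (Suc (m + 1 + n))) * (\<pi> (m + 1 + n) * \<pi> 1)
      \<le> q * ((r + real (1 + n)) / real (Suc (1 + n))) * (\<pi> (1 + n) * \<pi> (m + 1))"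
    using Suc.IH r_gt_1 p_less_1 pi_pos[of "m + 1 + n"] pi_pos[of 1]
    by (intro mult_mono[where a = "q * _"] mult_left_mono) auto
  then show ?case
    using step[of "m + 1 + n"] step[of "1 + n"] by (simp add: mult.assoc)
qed simp

text \<open>With \<open>m = nat \<lfloor>z\<rfloor>\<close>, the payoff vanishes up to
  \<open>m\<close> and is at most \<open>n + 1\<close> at \<open>m + 1 + n\<close>. Comparison with
  the weights from \<open>1\<close> on gives \<open>\<pi> (m + 1) / \<pi> 1\<close> times the mean,
  and \<open>\<mu> / \<pi> 1 = p powr (- (r + 1))\<close>.\<close>

lemma nb_excess_le:
  assumes "0 \<le> z"
  shows "nb_excess r p z \<le> p powr (- (r + 1)) * \<pi> (nat \<lfloor>z\<rfloor> + 1)"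
proof -
  define m where "m = nat \<lfloor>z\<rfloor>"
  have m: "real m \<le> z" "z \<le> real m + 1"
    using assms unfolding m_def by linarith+
  have pi1: "\<pi> 1 = r * q * p powr r"
    by (simp add: nb_pmf_pochhammer)
  have "(\<lambda>n. real (Suc n) * \<pi> (Suc n)) sums \<mu>"
    by (subst sums_Suc_iff) (use pi_mean_sums in \<open>simp add: mult.commute\<close>)
  from sums_mult[OF this, of "\<pi> (m + 1) / \<pi> 1"]
  have A: "(\<lambda>n. \<pi> (m + 1) / \<pi> 1 * (real (Suc n) * \<pi> (Suc n))) sums (\<pi> (m + 1) / \<pi> 1 * \<mu>)" .
  have "nb_excess r p z = (\<Sum>n. \<pi> (n + (m + 1)) * max (real (n + (m + 1)) - z) 0)
      + (\<Sum>j<m + 1. \<pi> j * max (real j - z) 0)"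
    unfolding nb_excess_def by (rule suminf_split_initial_segment[OF call_summable])
  also have "(\<Sum>j<m + 1. \<pi> j * max (real j - z) 0) = 0"
    using m by (intro sum.neutral) auto
  also have "(\<Sum>n. \<pi> (n + (m + 1)) * max (real (n + (m + 1)) - z) 0)
      \<le> (\<Sum>n. \<pi> (m + 1) / \<pi> 1 * (real (Suc n) * \<pi> (Suc n)))"
  proof (intro suminf_le sums_summable[OF A] summable_ignore_initial_segment[OF call_summable])
    fix n
    have "\<pi> (n + (m + 1)) \<le> \<pi> (m + 1) / \<pi> 1 * \<pi> (Suc n)"
      using pi_ratio_le[of m n] pi_pos[of 1] by (simp add: field_simps)
    then have "\<pi> (n + (m + 1)) * max (real (n + (m + 1)) - z) 0
        \<le> \<pi> (m + 1) / \<pi> 1 * \<pi> (Suc n) * real (Suc n)"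
      using m pi_pos by (intro mult_mono) (auto simp: less_imp_le)
    then show "\<pi> (n + (m + 1)) * max (real (n + (m + 1)) - z) 0
        \<le> \<pi> (m + 1) / \<pi> 1 * (real (Suc n) * \<pi> (Suc n))"
      by (simp add: mult_ac)
  qed
  also have "\<dots> = \<pi> (m + 1) / \<pi> 1 * \<mu>"
    using sums_unique[OF A] by simp
  also have "\<dots> = p powr (- (r + 1)) * \<pi> (m + 1)"
    unfolding pi1 using r_gt_1 p_pos p_less_1
    by (simp add: \<mu>_def powr_minus powr_add powr_diff divide_simps)
  finally show ?thesis
    by (simp add: m_def)
qed

lemma head_sum: "(\<Sum>j<k. \<pi> j * (\<mu> - real j)) = real k * \<pi> k / p"
  using tail_sum_eq_head[of real k] sums_summable[OF pi_mean_sums] sums_unique[OF pi_mean_sums]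
  by (simp add: tail_sum_id sum_negf[symmetric] right_diff_distrib)

text \<open>By detailed balance, the step from \<open>l\<close> to \<open>Suc l\<close> amounts to
  \<open>F * (q * r - p * l) \<le> q * (r + l) * \<pi> l\<close>. This follows from
  \<open>head_sum\<close> at \<open>Suc l\<close>, with each \<open>j \<le> l\<close> replaced by
  \<open>l\<close>.\<close>

lemma head_ratio_mono:
  assumes "0 < k" "k \<le> l"
  shows "(\<Sum>j<k. \<pi> j) / (real k * \<pi> k) \<le> (\<Sum>j<l. \<pi> j) / (real l * \<pi> l)"
  using assms(2)
proof (induction l rule: dec_induct)
  case (step l)
  define F where "F = (\<Sum>j<Suc l. \<pi> j)"
  have "F * ((q * r - p * real l) / p) = F * (\<mu> - real l)"
    using p_pos by (simp add: \<mu>_def diff_divide_distrib mult.commute)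
  also have "\<dots> \<le> (\<Sum>j<Suc l. \<pi> j * (\<mu> - real j))"
    unfolding F_def sum_distrib_right
    using pi_pos by (intro sum_mono mult_left_mono) (auto simp: less_imp_le)
  also have "\<dots> = q * (r + real l) * \<pi> l / p"
    using nb_pmf_Suc[of l r p] by (simp only: head_sum)
  finally have "F * (q * r - p * real l) \<le> q * (r + real l) * \<pi> l"
    using p_pos by (simp add: divide_le_cancel)
  then have "(F - \<pi> l) * (q * (r + real l)) \<le> F * real l"
    by (simp add: algebra_simps)
  then have "(F - \<pi> l) * (q * (r + real l)) * \<pi> l \<le> F * real l * \<pi> l"
    using pi_pos[of l] by (intro mult_right_mono) auto
  then have "(F - \<pi> l) / (real l * \<pi> l) \<le> F / (real (Suc l) * \<pi> (Suc l))"
    unfolding nb_pmf_Suc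
    using r_gt_1 p_less_1 pi_pos[of l] assms(1) step(1) by (simp add: divide_simps mult_ac)
  then show ?case
    using step.IH by (simp add: F_def)
qed simp

text \<open>The head ratio is largest at \<open>m + 1\<close>. There the head mass is at most one,
  and \<open>\<pi> (m + 1)\<close> cancels against the bound in \<open>nb_excess_le\<close>.\<close>

lemma abs_g_sol_left:
  assumes "0 \<le> z" "0 < k" "k \<le> nat \<lfloor>z\<rfloor> + 1"
  shows "\<bar>g_sol r p z k\<bar> \<le> p powr (- (r + 1)) / (real (nat \<lfloor>z\<rfloor>) + 1)"
proof -
  define m where "m = nat \<lfloor>z\<rfloor>"
  define e where "e = nb_excess r p z"
  have m: "real m \<le> z"
    using assms unfolding m_def by linarith
  have "e \<ge> 0"
    unfolding e_def nb_excess_def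
    using pi_pos by (intro suminf_nonneg call_summable) (simp add: less_imp_le)
  have "tail_sum (\<lambda>j. max (real j - z) 0) k = - (\<Sum>j<k. \<pi> j * (max (real j - z) 0 - e))"
    unfolding e_def nb_excess_def by (rule tail_sum_eq_head[OF call_summable])
  also have "(\<Sum>j<k. \<pi> j * (max (real j - z) 0 - e)) = (\<Sum>j<k. \<pi> j * (- e))"
    using assms m by (intro sum.cong) (auto simp: m_def max_def)
  also have "- \<dots> = e * (\<Sum>j<k. \<pi> j)"
    by (simp add: sum_distrib_left sum_negf mult.commute)
  finally have "\<bar>g_sol r p z k\<bar> = e * ((\<Sum>j<k. \<pi> j) / (real k * \<pi> k))"
    using \<open>e \<ge> 0\<close> pi_pos assms(2) by (simp add: g_sol_eq abs_mult sum_nonneg less_imp_le)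
  also have "\<dots> \<le> e * ((\<Sum>j<m + 1. \<pi> j) / (real (m + 1) * \<pi> (m + 1)))"
    using assms \<open>e \<ge> 0\<close> by (intro mult_left_mono head_ratio_mono) (auto simp: m_def)
  also have "\<dots> \<le> e * (1 / (real (m + 1) * \<pi> (m + 1)))"
    using \<open>e \<ge> 0\<close> pi_pos sum_le_suminf[OF pi_summable, of "{..<m + 1}"]
    by (intro mult_left_mono divide_right_mono) (auto simp: pi_suminf less_imp_le)
  also have "\<dots> \<le> p powr (- (r + 1)) * \<pi> (m + 1) * (1 / (real (m + 1) * \<pi> (m + 1)))"
    using nb_excess_le[OF assms(1)] pi_pos[of "m + 1"]
    by (intro mult_right_mono) (auto simp: e_def m_def)
  also have "\<dots> = p powr (- (r + 1)) / (real m + 1)"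
    using pi_pos[of "m + 1"] by simp
  finally show ?thesis
    by (simp add: m_def)
qed

section \<open>Tail ratios and increments at or above \<open>z\<close>\<close>

definition tail_ratio :: "nat \<Rightarrow> real" where
  "tail_ratio k = (\<Sum>n. \<pi> (k + n)) / (real k * \<pi> k)"

lemma pi_tail_summable: "summable (\<lambda>n. \<pi> (k + n))"
  using summable_ignore_initial_segment[OF pi_summable, of k] by (simp add: add.commute)

text \<open>Splitting off the first tail term gives
  \<open>k * tail_ratio k = 1 + q * (r + k) * tail_ratio (Suc k)\<close> for this discrete Mills
  ratio.\<close>

lemma tail_ratio_step:
  assumes "0 < k"
  shows "real k * (tail_ratio k - tail_ratio (Suc k)) = 1 - (p * real k - q * r) * tail_ratio (Suc k)"
proof -
  define G where "G = (\<Sum>n. \<pi> (Suc k + n))"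
  have "(\<Sum>n. \<pi> (k + n)) = \<pi> k + G"
    using suminf_split_head[OF pi_tail_summable[of k]] by (simp add: G_def)
  then have "real k * tail_ratio k = 1 + G / \<pi> k"
    using assms pi_pos[of k] by (simp add: tail_ratio_def field_simps)
  moreover have "q * (r + real k) * tail_ratio (Suc k) = G / \<pi> k"
    unfolding tail_ratio_def nb_pmf_Suc G_def[symmetric]
    using r_gt_1 p_less_1 pi_pos[of k] by simp
  ultimately show ?thesis
    by (simp add: algebra_simps)
qed

text \<open>Every tail index \<open>j\<close> exceeds \<open>k\<close>, so \<open>k - \<mu>\<close>
  is at most \<open>j - \<mu>\<close>, whose weighted tail telescopes. With
  \<open>tail_ratio_step\<close> this makes the tail ratio nonincreasing.\<close>

lemma tail_ratio_le:
  assumes "0 < k"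
  shows "(p * real k - q * r) * tail_ratio (Suc k) \<le> 1"
proof -
  have "(\<Sum>n. \<pi> (Suc k + n)) * ((p * real k - q * r) / p) = (\<Sum>n. \<pi> (Suc k + n)) * (real k - \<mu>)"
    using p_pos by (simp add: \<mu>_def diff_divide_distrib mult.commute)
  also have "\<dots> = (\<Sum>n. \<pi> (Suc k + n) * (real k - \<mu>))"
    by (rule suminf_mult2[OF pi_tail_summable])
  also have "\<dots> \<le> (\<Sum>n. \<pi> (Suc k + n) * (real (Suc k + n) - \<mu>))"
    using pi_pos by (intro suminf_le mult_left_mono summable_mult2 pi_tail_summable
      sums_summable[OF tail_sum_id_sums]) (auto simp: less_imp_le)
  also have "\<dots> = real (Suc k) * \<pi> (Suc k) / p"
    by (rule sums_unique[OF tail_sum_id_sums, symmetric])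
  finally have "(\<Sum>n. \<pi> (Suc k + n)) * (p * real k - q * r) \<le> real (Suc k) * \<pi> (Suc k)"
    using p_pos by (simp add: divide_le_cancel)
  then show ?thesis
    using pi_pos[of "Suc k"] by (simp add: tail_ratio_def pos_divide_le_eq mult.commute del: of_nat_Suc)
qed

text \<open>Since \<open>r > 1\<close>, each weight in the tail is at least \<open>q\<close> times
  its predecessor, so the tail dominates a geometric series.\<close>

lemma tail_ratio_ge:
  assumes "0 < k"
  shows "1 / (real k * p) \<le> tail_ratio k"
proof -
  have "\<pi> k * q ^ n \<le> \<pi> (k + n)" for n
  proof (induction n)
    case (Suc n)
    have "q * real (Suc (k + n)) * \<pi> (k + n) \<le> q * (r + real (k + n)) * \<pi> (k + n)"
      using r_gt_1 p_less_1 pi_pos[of "k + n"] by (intro mult_right_mono mult_left_mono) auto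
    also have "\<dots> = real (Suc (k + n)) * \<pi> (Suc (k + n))"
      by (rule nb_pmf_Suc[symmetric])
    finally have "q * \<pi> (k + n) \<le> \<pi> (Suc (k + n))"
      by (simp add: mult_ac del: of_nat_Suc)
    moreover have "q * (\<pi> k * q ^ n) \<le> q * \<pi> (k + n)"
      using Suc p_less_1 by simp
    ultimately show ?case
      by (simp add: mult_ac)
  qed simp
  then have "(\<Sum>n. \<pi> k * q ^ n) \<le> (\<Sum>n. \<pi> (k + n))"
    using p_pos p_less_1 by (intro suminf_le summable_mult summable_geometric pi_tail_summable) auto
  moreover have "(\<Sum>n. \<pi> k * q ^ n) = \<pi> k / p"
    using p_pos p_less_1 by (simp add: suminf_mult summable_geometric suminf_geometric)
  ultimately show ?thesis
    using assms p_pos pi_pos[of k] by (simp add: tail_ratio_def field_simps)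
qed

text \<open>The whole tail lies where the payoff is \<open>j - z\<close>. The coefficient of
  \<open>tail_ratio k\<close> is the put value \<open>E (z - N)\<^sup>+\<close>, written by put-call
  parity.\<close>

lemma g_sol_right:
  assumes "z \<le> real k" "0 < k"
  shows "g_sol r p z k = - 1 / p + (z + nb_excess r p z - \<mu>) * tail_ratio k"
proof -
  define e where "e = nb_excess r p z"
  have "tail_sum (\<lambda>j. max (real j - z) 0) k = (\<Sum>n. \<pi> (k + n) * (real (k + n) - \<mu>) - \<pi> (k + n) * (z + e - \<mu>))"
    unfolding tail_sum_def nb_excess_def[symmetric] e_def[symmetric]
    using assms by (intro suminf_cong) (simp add: max_absorb1 algebra_simps)
  also have "\<dots> = real k * \<pi> k / p - (\<Sum>n. \<pi> (k + n)) * (z + e - \<mu>)"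
    unfolding sums_unique[OF tail_sum_id_sums] suminf_mult2[OF pi_tail_summable]
    by (intro suminf_diff[symmetric] sums_summable[OF tail_sum_id_sums] summable_mult2 pi_tail_summable)
  finally show ?thesis
    using assms pi_pos[of k] p_pos by (simp add: g_sol_eq tail_ratio_def e_def field_simps)
qed

text \<open>Average \<open>(j - z)\<^sup>+ \<le> j \<le> (j - z)\<^sup>+ + z\<close> over the
  weights.\<close>

lemma put_bounds:
  assumes "0 \<le> z"
  shows "0 \<le> z + nb_excess r p z - \<mu>" and "z + nb_excess r p z - \<mu> \<le> z"
proof -
  have s: "summable (\<lambda>j. \<pi> j * real j)" "summable (\<lambda>j. \<pi> j * max (real j - z) 0)"
    by (rule sums_summable[OF pi_mean_sums], rule call_summable)
  have "nb_excess r p z \<le> (\<Sum>j. \<pi> j * real j)"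
    unfolding nb_excess_def using assms pi_pos
    by (intro suminf_le s mult_left_mono) (auto simp: less_imp_le)
  then show "z + nb_excess r p z - \<mu> \<le> z"
    using sums_unique[OF pi_mean_sums] by simp
  have "(\<Sum>j. \<pi> j * real j) \<le> (\<Sum>j. \<pi> j * max (real j - z) 0 + \<pi> j * z)"
    unfolding distrib_left[symmetric]
    using pi_pos summable_add[OF s(2) summable_mult2[OF pi_summable, of z]]
    by (intro suminf_le s mult_left_mono) (auto simp: less_imp_le distrib_left)
  also have "\<dots> = nb_excess r p z + z"
    using suminf_add[OF s(2) summable_mult2[OF pi_summable, of z]] suminf_mult2[OF pi_summable, of z]
    by (simp add: nb_excess_def pi_suminf)
  finally show "0 \<le> z + nb_excess r p z - \<mu>"
    using sums_unique[OF pi_mean_sums] by simp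
qed

text \<open>At or above the mean, the increment is \<open>- e / k\<close> times \<open>D\<close>,
  with \<open>e \<le> z \<le> k\<close>, so a bound on \<open>D\<close> suffices. Below the mean,
  \<open>z \<le> k < \<mu>\<close> keeps \<open>z\<close> so small that the bound
  \<open>1 / p\<close> is enough.\<close>

lemma abs_g_sol_diff_right:
  assumes "0 < z" "z \<le> real k"
  shows "\<bar>g_sol r p z (Suc k) - g_sol r p z k\<bar> \<le> (r + 1) / (p\<^sup>2 * z)"
proof (cases "p * real k \<ge> q * r")
  case True
  define e where "e = z + nb_excess r p z - \<mu>"
  have e: "0 \<le> e" "e \<le> z"
    using put_bounds[of z] assms by (auto simp: e_def)
  have k: "0 < k"
    using assms by (cases k) auto
  define D where "D = real k * (tail_ratio k - tail_ratio (Suc k))"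
  have D0: "0 \<le> D"
    unfolding D_def using tail_ratio_step[OF k] tail_ratio_le[OF k] by simp
  \<comment> \<open>The factor \<open>p * k - q * r\<close> is nonnegative in this case, so the
    geometric lower bound can be inserted into the recursion; this is what makes \<open>D\<close>
    decay.\<close>
  have "(p * real k - q * r) * (1 / (real (Suc k) * p)) \<le> (p * real k - q * r) * tail_ratio (Suc k)"
    using True by (intro mult_left_mono tail_ratio_ge) auto
  then have "D \<le> 1 - (p * real k - q * r) / (real (Suc k) * p)"
    unfolding D_def using tail_ratio_step[OF k] by simp
  also have "\<dots> = (p + q * r) / (real (Suc k) * p)"
    using p_pos by (simp add: divide_simps) (simp add: algebra_simps)
  also have "\<dots> \<le> (p + q * r) / (z * p)"
    using assms p_pos p_less_1 r_gt_1 by (intro divide_left_mono mult_right_mono) auto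
  also have "\<dots> \<le> (r + 1) / (p\<^sup>2 * z)"
  proof -
    have "q * r \<le> 1 * r"
      using p_pos r_gt_1 by (intro mult_right_mono) auto
    then have "p + q * r \<le> r + 1"
      using p_less_1 by linarith
    then have "(p + q * r) * p \<le> (r + 1) * 1"
      using p_pos p_less_1 r_gt_1 by (intro mult_mono) auto
    then have "(p + q * r) * p / (p\<^sup>2 * z) \<le> (r + 1) / (p\<^sup>2 * z)"
      using p_pos assms by (intro divide_right_mono) auto
    then show ?thesis
      using p_pos by (simp add: power2_eq_square mult.commute)
  qed
  finally have D1: "D \<le> (r + 1) / (p\<^sup>2 * z)" .
  have "g_sol r p z (Suc k) - g_sol r p z k = - (e / real k * D)"
    using k assms by (simp add: g_sol_right e_def[symmetric] D_def field_simps)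
  then have "\<bar>g_sol r p z (Suc k) - g_sol r p z k\<bar> = e / real k * D"
    using e D0 by simp
  also have "\<dots> \<le> 1 * D"
    using e D0 assms k by (intro mult_right_mono) auto
  finally show ?thesis
    using D1 by simp
next
  case False
  have "q * r \<le> 1 * r"
    using p_pos r_gt_1 by (intro mult_right_mono) auto
  moreover have "p * z \<le> p * real k"
    using assms p_pos by simp
  ultimately have "p * z \<le> r + 1"
    using False by linarith
  then have "1 / p \<le> (r + 1) / (p\<^sup>2 * z)"
    using assms p_pos by (simp add: field_simps power2_eq_square)
  then show ?thesis
    using abs_g_sol_diff_le[of z k] by linarith
qed

text \<open>For \<open>k \<le> nat \<lfloor>z\<rfloor>\<close> both values lie in the left region
  and are nonpositive, so their difference is at most the common bound. Otherwise
  \<open>z \<le> k\<close> and the right-hand estimate applies.\<close>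

lemma g_sol_diff_nonuniform:
  assumes "0 < z" "0 < k"
  shows "\<bar>g_sol r p z (Suc k) - g_sol r p z k\<bar>
    \<le> (r + 1) / z * ((1 + 1 / q) * p powr (- (r + 2)) - p powr (- 2))"
proof -
  define P where "P = p powr (- (r + 2))"
  have q: "1 \<le> 1 / q"
    using p_pos p_less_1 by simp
  have P1: "p powr (- 2) \<le> P" "p powr (- (r + 1)) \<le> P" "0 < P"
    unfolding P_def using r_gt_1 p_pos p_less_1 by (auto intro!: powr_mono')
  \<comment> \<open>As \<open>1 / q \<ge> 1\<close> and \<open>P \<ge> p powr (- 2)\<close>, the
    bracket in the claim is at least \<open>P\<close>, so it is enough to reach
    \<open>(r + 1) / z * P\<close>.\<close>
  have "1 * P \<le> 1 / q * P"
    using q P1 by (intro mult_right_mono) auto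
  then have PQ: "P \<le> (1 + 1 / q) * P - p powr (- 2)"
    using P1 by (simp add: distrib_right)
  have p2: "p powr (- 2) = 1 / p\<^sup>2"
    using p_pos by (simp add: powr_minus powr_numeral divide_inverse)
  have "\<bar>g_sol r p z (Suc k) - g_sol r p z k\<bar> \<le> (r + 1) / z * P"
  proof (cases "k \<le> nat \<lfloor>z\<rfloor>")
    case True
    define b where "b = p powr (- (r + 1)) / (real (nat \<lfloor>z\<rfloor>) + 1)"
    have "\<bar>g_sol r p z (Suc k)\<bar> \<le> b" "\<bar>g_sol r p z k\<bar> \<le> b"
      unfolding b_def using True assms by (intro abs_g_sol_left; simp)+
    moreover have "g_sol r p z (Suc k) \<le> 0" "g_sol r p z k \<le> 0"
      by (rule g_sol_nonpos)+
    ultimately have "\<bar>g_sol r p z (Suc k) - g_sol r p z k\<bar> \<le> b"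
      by linarith
    also have "b \<le> P / z"
      unfolding b_def using P1 assms by (intro frac_le) linarith+
    also have "\<dots> \<le> (r + 1) / z * P"
      using r_gt_1 assms P1 by (simp add: divide_simps)
    finally show ?thesis .
  next
    case False
    then have "z \<le> real k"
      using assms by linarith
    from abs_g_sol_diff_right[OF assms(1) this]
    have "\<bar>g_sol r p z (Suc k) - g_sol r p z k\<bar> \<le> (r + 1) / z * p powr (- 2)"
      using p2 by (simp add: mult.commute)
    also have "\<dots> \<le> (r + 1) / z * P"
      using r_gt_1 assms P1 by (intro mult_left_mono) auto
    finally show ?thesis .
  qed
  also have "\<dots> \<le> (r + 1) / z * ((1 + 1 / q) * P - p powr (- 2))"
    using r_gt_1 assms PQ by (intro mult_left_mono) auto
  finally show ?thesis
    unfolding P_def .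
qed

end

section \<open>Conditional unit shifts\<close>

lemma measurable_count_space_Pair:
  fixes X :: "'a \<Rightarrow> 'b::countable" and Y :: "'a \<Rightarrow> 'c::countable"
  assumes "X \<in> measurable M (count_space UNIV)" "Y \<in> measurable M (count_space UNIV)"
  shows "(\<lambda>w. (X w, Y w)) \<in> measurable M (count_space UNIV)"
proof (rule measurable_compose_countable[OF _ assms(1)])
  show "(\<lambda>w. (x, Y w)) \<in> measurable M (count_space UNIV)" for x
    by (rule measurable_compose[OF assms(2)]) simp
qed

lemma measurable_zsum:
  assumes "finite S" "\<And>j. j \<in> S \<Longrightarrow> \<zeta> j \<in> measurable M (count_space UNIV)"
  shows "zsum \<zeta> S \<in> measurable M (count_space UNIV)"
proof -
  have "(\<lambda>w. \<Sum>j\<in>S. \<zeta> j w) \<in> measurable M (count_space UNIV)"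
    using assms by (induction S rule: finite_induct)
      (auto intro!: measurable_compose_countable[of "\<lambda>n w. n + _ w"] measurable_compose[of _ M])
  then show ?thesis
    by (simp add: zsum_def [abs_def])
qed

text \<open>Used for the values of \<open>V\<close> in the summation by parts and for codes of the
  values of \<open>X\<close> in the conditioning. Disjoint level sets bound the partial sums of
  absolute integrals, which justifies exchanging sum and integral.\<close>

lemma integral_eq_suminf_level_sets:
  fixes f :: "'a \<Rightarrow> real" and N :: "'a \<Rightarrow> nat"
  assumes N: "N \<in> measurable M (count_space UNIV)" and f: "integrable M f"
  shows "(\<lambda>n. \<integral>w. indicator {v \<in> space M. N v = n} w * f w \<partial>M) sums (\<integral>w. f w \<partial>M)"
proof -
  define A where "A n = {v \<in> space M. N v = n}" for n
  have A [measurable]: "A n \<in> sets M" for n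
    using measurable_sets[OF N, of "{n}"] by (simp add: A_def vimage_def Int_def conj_commute)
  have int: "integrable M (\<lambda>w. indicator (A n) w * f w)" for n
    using integrable_mult_indicator[OF A f, of n] by simp
  have pt: "(\<lambda>n. indicator (A n) w * f w) sums f w" if "w \<in> space M" for w
  proof -
    have "(\<lambda>n. if n = N w then f w else 0) sums f w"
      by (rule sums_single)
    moreover have "(if n = N w then f w else 0) = indicator (A n) w * f w" for n
      using that by (auto simp: A_def)
    ultimately show ?thesis
      by simp
  qed
  have pt': "(\<lambda>n. norm (indicator (A n) w * f w)) sums norm (f w)" if "w \<in> space M" for w
  proof -
    have "(\<lambda>n. if n = N w then norm (f w) else 0) sums norm (f w)"
      by (rule sums_single)
    moreover have "(if n = N w then norm (f w) else 0) = norm (indicator (A n) w * f w)" for n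
      using that by (auto simp: A_def)
    ultimately show ?thesis
      by simp
  qed
  have "(\<lambda>n. \<integral>w. indicator (A n) w * f w \<partial>M) sums (\<integral>w. (\<Sum>n. indicator (A n) w * f w) \<partial>M)"
  proof (rule sums_integral[OF int])
    show "AE w in M. summable (\<lambda>n. norm (indicator (A n) w * f w))"
      by (intro AE_I2 sums_summable[OF pt'])
    show "summable (\<lambda>n. \<integral>w. norm (indicator (A n) w * f w) \<partial>M)"
    proof (rule summableI_nonneg_bounded)
      fix n
      have "(\<Sum>i<n. \<integral>w. norm (indicator (A i) w * f w) \<partial>M) = (\<integral>w. (\<Sum>i<n. norm (indicator (A i) w * f w)) \<partial>M)"
        by (rule Bochner_Integration.integral_sum[symmetric]) (intro integrable_norm int)
      also have "\<dots> \<le> (\<integral>w. norm (f w) \<partial>M)"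
      proof (intro integral_mono Bochner_Integration.integrable_sum integrable_norm int f)
        fix w assume w: "w \<in> space M"
        show "(\<Sum>i<n. norm (indicator (A i) w * f w)) \<le> norm (f w)"
          using sum_le_suminf[OF sums_summable[OF pt'[OF w]], of "{..<n}"] sums_unique[OF pt'[OF w]]
          by simp
      qed
      finally show "(\<Sum>i<n. \<integral>w. norm (indicator (A i) w * f w) \<partial>M) \<le> (\<integral>w. norm (f w) \<partial>M)" .
    qed simp
  qed
  also have "(\<integral>w. (\<Sum>n. indicator (A n) w * f w) \<partial>M) = (\<integral>w. f w \<partial>M)"
    by (intro Bochner_Integration.integral_cong refl sums_unique[OF pt, symmetric])
  finally show ?thesis
    by (simp add: A_def)
qed

section \<open>Summation by parts given a discrete variable\<close>

context prob_space
begin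

context
  fixes V :: "'a \<Rightarrow> nat" and X :: "'a \<Rightarrow> 'b::countable"
  assumes V [measurable]: "V \<in> measurable M (count_space UNIV)"
    and X [measurable]: "X \<in> measurable M (count_space UNIV)"
begin

abbreviation joint :: "'b \<Rightarrow> nat \<Rightarrow> real" where
  "joint x k \<equiv> prob {v \<in> space M. V v = k \<and> X v = x}"

text \<open>Joint masses instead of conditional ones: the division is deferred to
  \<open>shiftD_eq\<close>, so the summation by parts also covers null events.\<close>

definition shift_diff :: "'b \<Rightarrow> nat \<Rightarrow> real" where
  "shift_diff x k = joint x k - (if k = 0 then 0 else joint x (k - 1))"

lemma shiftD_eq:
  "shiftD M V X w = (\<Sum>k. \<bar>shift_diff (X w) k\<bar>) / prob {v \<in> space M. X v = X w}"
  by (simp add: shiftD_def shift_diff_def)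

lemma joint_sums: "joint x sums prob {v \<in> space M. X v = x}"
proof -
  have "(\<lambda>n. prob ((\<lambda>k. {v \<in> space M. V v = k \<and> X v = x}) n))
      sums prob (\<Union>n. {v \<in> space M. V v = n \<and> X v = x})"
    by (rule finite_measure_UNION) (auto simp: disjoint_family_on_def)
  also have "(\<Union>n. {v \<in> space M. V v = n \<and> X v = x}) = {v \<in> space M. X v = x}"
    by auto
  finally show ?thesis .
qed

lemma joint_pred_sums: "(\<lambda>k. if k = 0 then 0 else joint x (k - 1)) sums prob {v \<in> space M. X v = x}"
  using joint_sums[of x] by (subst sums_Suc_iff[symmetric, of "\<lambda>k. if k = 0 then 0 else joint x (k - 1)", simplified]) simp

text \<open>The masses and the shifted masses each add up to the probability of
  \<open>X = x\<close>, and a difference of nonnegative numbers is at most their sum.\<close>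

lemma
  shows shift_diff_summable: "summable (\<lambda>k. \<bar>shift_diff x k\<bar>)"
    and shift_diff_suminf_le: "(\<Sum>k. \<bar>shift_diff x k\<bar>) \<le> 2 * prob {v \<in> space M. X v = x}"
proof -
  have s: "(\<lambda>k. joint x k + (if k = 0 then 0 else joint x (k - 1)))
      sums (prob {v \<in> space M. X v = x} + prob {v \<in> space M. X v = x})"
    by (intro sums_add joint_sums joint_pred_sums)
  have le: "\<bar>shift_diff x k\<bar> \<le> joint x k + (if k = 0 then 0 else joint x (k - 1))" for k
    using measure_nonneg[of M "{v \<in> space M. V v = k \<and> X v = x}"]
      measure_nonneg[of M "{v \<in> space M. V v = k - 1 \<and> X v = x}"]
    unfolding shift_diff_def by (auto simp: abs_le_iff)
  show sm: "summable (\<lambda>k. \<bar>shift_diff x k\<bar>)"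
    by (rule summable_comparison_test'[OF sums_summable[OF s]]) (use le in simp)
  show "(\<Sum>k. \<bar>shift_diff x k\<bar>) \<le> 2 * prob {v \<in> space M. X v = x}"
    using suminf_le[OF le sm sums_summable[OF s]] sums_unique[OF s] by simp
qed

lemma shiftD_nonneg: "0 \<le> shiftD M V X w"
  unfolding shiftD_eq by (intro divide_nonneg_nonneg suminf_nonneg shift_diff_summable) auto

lemma shiftD_le_2: "shiftD M V X w \<le> 2"
  unfolding shiftD_eq using shift_diff_suminf_le[of "X w"]
  \<comment> \<open>On a null event the quotient is \<open>0\<close>, the value of division by
    zero.\<close>
  by (cases "prob {v \<in> space M. X v = X w} = 0")
    (auto simp: divide_simps zero_less_measure_iff)

lemma borel_measurable_shiftD: "shiftD M V X \<in> borel_measurable M"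
proof -
  have "(\<lambda>x. (\<Sum>k. \<bar>shift_diff x k\<bar>) / prob {v \<in> space M. X v = x}) \<in> borel_measurable (count_space UNIV)"
    by simp
  from measurable_compose[OF X this] show ?thesis
    by (simp add: shiftD_eq[abs_def])
qed

lemma integrable_mult_shiftD:
  assumes "integrable M f"
  shows "integrable M (\<lambda>w. f w * shiftD M V X w)"
proof (rule Bochner_Integration.integrable_bound[of _ "\<lambda>w. f w * 2"])
  show "integrable M (\<lambda>w. f w * 2)"
    using assms by simp
  show "(\<lambda>w. f w * shiftD M V X w) \<in> borel_measurable M"
    using assms borel_measurable_shiftD by auto
  show "AE w in M. norm (f w * shiftD M V X w) \<le> norm (f w * 2)"
    using shiftD_nonneg shiftD_le_2 by (auto simp: abs_mult intro!: mult_left_mono)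
qed

text \<open>Summation by parts on the event \<open>X = x\<close>.\<close>
lemma abs_integral_shift_event:
  fixes h :: "nat \<Rightarrow> real"
  assumes h: "\<And>k. \<bar>h k\<bar> \<le> c"
  shows "\<bar>\<integral>w. indicator {v \<in> space M. X v = x} w * (h (Suc (V w)) - h (V w)) \<partial>M\<bar>
    \<le> c * (\<Sum>k. \<bar>shift_diff x k\<bar>)"
proof -
  define A where "A = {v \<in> space M. X v = x}"
  have A [measurable]: "A \<in> sets M"
    by (simp add: A_def)
  have c: "0 \<le> c"
    using h[of 0] by linarith
  have hm: "(\<lambda>w. h (Suc (V w))) \<in> borel_measurable M" "(\<lambda>w. h (V w)) \<in> borel_measurable M"
    by (auto intro!: measurable_compose[OF V])
  have int: "integrable M (\<lambda>w. indicator A w * h (Suc (V w)))" "integrable M (\<lambda>w. indicator A w * h (V w))"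
    using hm h c
    by (auto intro!: integrable_const_bound[of _ c] simp: abs_mult indicator_def)
  have lev: "(\<integral>w. indicator {v \<in> space M. V v = k} w * (indicator A w * u (V w)) \<partial>M) = u k * joint x k"
    for u :: "nat \<Rightarrow> real" and k
  proof -
    have "(\<integral>w. indicator {v \<in> space M. V v = k} w * (indicator A w * u (V w)) \<partial>M)
        = (\<integral>w. u k * indicator {v \<in> space M. V v = k \<and> X v = x} w \<partial>M)"
      by (intro Bochner_Integration.integral_cong) (auto simp: A_def indicator_def)
    also have "\<dots> = u k * joint x k"
      by (simp add: Int_def conj_commute conj_left_commute)
    finally show ?thesis .
  qed
  have s1: "(\<lambda>k. h (Suc k) * joint x k) sums (\<integral>w. indicator A w * h (Suc (V w)) \<partial>M)"
    using integral_eq_suminf_level_sets[OF V int(1)] lev[of _ "\<lambda>n. h (Suc n)"] by simp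
  have s2: "(\<lambda>k. h k * joint x k) sums (\<integral>w. indicator A w * h (V w) \<partial>M)"
    using integral_eq_suminf_level_sets[OF V int(2)] lev[of _ h] by simp
  \<comment> \<open>Reindexing by one moves the shift from \<open>h\<close> to the masses; the value
    \<open>0\<close> at \<open>k = 0\<close> stands for the missing predecessor.\<close>
  have s1': "(\<lambda>k. h k * (if k = 0 then 0 else joint x (k - 1))) sums (\<integral>w. indicator A w * h (Suc (V w)) \<partial>M)"
    using s1 by (subst sums_Suc_iff[symmetric, of "\<lambda>k. h k * (if k = 0 then 0 else joint x (k - 1))", simplified]) simp
  have "(\<lambda>k. h k * shift_diff x k) sums ((\<integral>w. indicator A w * h (V w) \<partial>M) - (\<integral>w. indicator A w * h (Suc (V w)) \<partial>M))"
    using sums_diff[OF s2 s1'] by (simp add: shift_diff_def right_diff_distrib)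
  then have eq: "(\<integral>w. indicator A w * (h (Suc (V w)) - h (V w)) \<partial>M) = - (\<Sum>k. h k * shift_diff x k)"
    using int by (simp add: right_diff_distrib sums_iff)
  have le: "norm (h k * shift_diff x k) \<le> c * \<bar>shift_diff x k\<bar>" for k
    using h[of k] by (simp add: abs_mult mult_right_mono)
  have sm: "summable (\<lambda>k. c * \<bar>shift_diff x k\<bar>)"
    by (intro summable_mult shift_diff_summable)
  have "norm (\<Sum>k. h k * shift_diff x k) \<le> (\<Sum>k. c * \<bar>shift_diff x k\<bar>)"
    using le sm by (rule norm_suminf_le)
  also have "\<dots> = c * (\<Sum>k. \<bar>shift_diff x k\<bar>)"
    by (intro suminf_mult shift_diff_summable)
  finally show ?thesis
    using eq by (simp add: A_def)
qed

text \<open>On \<open>X = x\<close> the integrand is constant, and the denominator of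
  \<open>shiftD\<close> cancels against the probability of the event. On a null event the numerator
  vanishes too.\<close>

lemma integral_shiftD_event:
  "(\<integral>w. indicator {v \<in> space M. X v = x} w * (c (X w) * shiftD M V X w) \<partial>M)
    = c x * (\<Sum>k. \<bar>shift_diff x k\<bar>)"
proof -
  define P where "P = prob {v \<in> space M. X v = x}"
  have "(\<integral>w. indicator {v \<in> space M. X v = x} w * (c (X w) * shiftD M V X w) \<partial>M)
      = (\<integral>w. c x * ((\<Sum>k. \<bar>shift_diff x k\<bar>) / P) * indicator {v \<in> space M. X v = x} w \<partial>M)"
    by (intro Bochner_Integration.integral_cong) (auto simp: indicator_def shiftD_eq P_def)
  also have "\<dots> = c x * ((\<Sum>k. \<bar>shift_diff x k\<bar>) / P) * P"
    by (simp add: P_def Int_def conj_commute conj_left_commute)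
  also have "\<dots> = c x * (\<Sum>k. \<bar>shift_diff x k\<bar>)"
  proof (cases "P = 0")
    case True
    then have "(\<Sum>k. \<bar>shift_diff x k\<bar>) = 0"
      using shift_diff_suminf_le[of x] suminf_nonneg[OF shift_diff_summable[of x]] by (simp add: P_def)
    then show ?thesis
      by simp
  qed simp
  finally show ?thesis .
qed

text \<open>The expectation is cut into slices \<open>X = x\<close>, on which \<open>H x\<close> is
  a fixed function bounded by \<open>c x\<close> and the event version applies. The slices are
  indexed by \<open>to_nat\<close>; numbers coding no value give empty slices.\<close>

lemma abs_expectation_shift_le:
  fixes H :: "'b \<Rightarrow> nat \<Rightarrow> real" and c :: "'b \<Rightarrow> real"
  assumes H: "\<And>x k. \<bar>H x k\<bar> \<le> c x" and c: "integrable M (\<lambda>w. c (X w))"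
  shows "integrable M (\<lambda>w. H (X w) (Suc (V w)) - H (X w) (V w))"
    and "\<bar>expectation (\<lambda>w. H (X w) (Suc (V w)) - H (X w) (V w))\<bar> \<le> expectation (\<lambda>w. c (X w) * shiftD M V X w)"
proof -
  define \<phi> where "\<phi> w = H (X w) (Suc (V w)) - H (X w) (V w)" for w
  define \<psi> where "\<psi> w = c (X w) * shiftD M V X w" for w
  have "(\<lambda>w. (X w, V w)) \<in> measurable M (count_space UNIV)"
    by (rule measurable_count_space_Pair[OF X V])
  from measurable_compose[OF this, of "\<lambda>(x, k). H x (Suc k) - H x k" borel]
  have m: "\<phi> \<in> borel_measurable M"
    by (simp add: \<phi>_def[abs_def])
  show i: "integrable M \<phi>"
  proof (rule Bochner_Integration.integrable_bound[of _ "\<lambda>w. 2 * c (X w)"])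
    have "norm (\<phi> w) \<le> norm (2 * c (X w))" for w
      using H[of "X w" "Suc (V w)"] H[of "X w" "V w"] by (simp add: \<phi>_def)
    then show "AE w in M. norm (\<phi> w) \<le> norm (2 * c (X w))"
      by simp
  qed (use m c in auto)
  have j: "integrable M \<psi>"
    unfolding \<psi>_def by (rule integrable_mult_shiftD[OF c])
  define N where "N w = to_nat (X w)" for w
  have N: "N \<in> measurable M (count_space UNIV)"
    unfolding N_def by (rule measurable_compose[OF X]) simp
  have s1: "(\<lambda>n. \<integral>w. indicator {v \<in> space M. N v = n} w * \<phi> w \<partial>M) sums expectation \<phi>"
    by (rule integral_eq_suminf_level_sets[OF N i])
  have s2: "(\<lambda>n. \<integral>w. indicator {v \<in> space M. N v = n} w * \<psi> w \<partial>M) sums expectation \<psi>"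
    by (rule integral_eq_suminf_level_sets[OF N j])
  have le: "norm (\<integral>w. indicator {v \<in> space M. N v = n} w * \<phi> w \<partial>M)
      \<le> (\<integral>w. indicator {v \<in> space M. N v = n} w * \<psi> w \<partial>M)" for n
  proof (cases "n \<in> range (to_nat :: 'b \<Rightarrow> nat)")
    case True
    then obtain x :: 'b where x: "n = to_nat x"
      by auto
    have A: "{v \<in> space M. N v = n} = {v \<in> space M. X v = x}"
      by (auto simp: N_def x)
    have "(\<integral>w. indicator {v \<in> space M. X v = x} w * \<phi> w \<partial>M)
        = (\<integral>w. indicator {v \<in> space M. X v = x} w * (H x (Suc (V w)) - H x (V w)) \<partial>M)"
      by (intro Bochner_Integration.integral_cong) (auto simp: indicator_def \<phi>_def)
    then show ?thesis
      unfolding A \<psi>_def integral_shiftD_event using abs_integral_shift_event[of "H x" "c x" x] H by simp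
  next
    case False
    then have "{v \<in> space M. N v = n} = {}"
      by (auto simp: N_def)
    then show ?thesis
      by simp
  qed
  have "norm (\<Sum>n. \<integral>w. indicator {v \<in> space M. N v = n} w * \<phi> w \<partial>M)
      \<le> (\<Sum>n. \<integral>w. indicator {v \<in> space M. N v = n} w * \<psi> w \<partial>M)"
    using le sums_summable[OF s2] by (rule norm_suminf_le)
  then show "\<bar>expectation \<phi>\<bar> \<le> expectation \<psi>"
    using sums_unique[OF s1] sums_unique[OF s2] by simp
qed

end

end

section \<open>Independence and telescoping into unit shifts\<close>

lemma zsum_split:
  assumes "finite T" "S \<subseteq> T"
  shows "zsum \<zeta> T w = zsum \<zeta> (T - S) w + zsum \<zeta> S w"
  using assms by (simp add: zsum_def sum.subset_diff)

text \<open>Counts the unit shifts. With \<open>n\<close> the sum over \<open>A i\<close> and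
  \<open>c\<close> the sum over \<open>B i\<close> outside \<open>A i\<close>, the factor
  \<open>2 * c + n - 1\<close> becomes the \<open>2 * Z (B i) w - Z (A i) w - 1\<close> of the
  second-order bound.\<close>

lemma sum_shifted_count: "(\<Sum>j<n. real (c + j)) = real n * (2 * real c + real n - 1) / 2"
  by (induction n) (auto simp: field_simps)

context prob_space
begin

text \<open>A general functional of the family on \<open>S\<close> against a function of the sum
  over \<open>T\<close> serves both levels of independence.\<close>

lemma indep_restrict_expectation_mult:
  fixes \<zeta> :: "nat \<Rightarrow> 'a \<Rightarrow> nat" and F :: "(nat \<Rightarrow> nat) \<Rightarrow> real" and u :: "nat \<Rightarrow> real"
  assumes ind: "indep_var (PiM S (\<lambda>_. count_space UNIV)) (\<lambda>w. restrict (\<lambda>j. \<zeta> j w) S)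
      (PiM T (\<lambda>_. count_space UNIV)) (\<lambda>w. restrict (\<lambda>j. \<zeta> j w) T)"
    and F: "F \<in> borel_measurable (PiM S (\<lambda>_. count_space UNIV))" and T: "finite T"
    and int: "integrable M (\<lambda>w. F (restrict (\<lambda>j. \<zeta> j w) S))" "integrable M (\<lambda>w. u (zsum \<zeta> T w))"
  shows "expectation (\<lambda>w. F (restrict (\<lambda>j. \<zeta> j w) S) * u (zsum \<zeta> T w))
    = expectation (\<lambda>w. F (restrict (\<lambda>j. \<zeta> j w) S)) * expectation (\<lambda>w. u (zsum \<zeta> T w))"
proof -
  have "(\<lambda>f. zsum (\<lambda>j f. f j) T f) \<in> measurable (PiM T (\<lambda>_. count_space UNIV)) (count_space UNIV)"
    by (intro measurable_zsum T measurable_component_singleton)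
  from measurable_compose[OF this, of u borel]
  have u: "(\<lambda>f. u (\<Sum>j\<in>T. f j)) \<in> borel_measurable (PiM T (\<lambda>_. count_space UNIV))"
    by (simp add: zsum_def)
  have "indep_var borel (F \<circ> (\<lambda>w. restrict (\<lambda>j. \<zeta> j w) S))
      borel ((\<lambda>f. u (\<Sum>j\<in>T. f j)) \<circ> (\<lambda>w. restrict (\<lambda>j. \<zeta> j w) T))"
    by (rule indep_var_compose[OF ind F u])
  moreover have "(\<lambda>f. u (\<Sum>j\<in>T. f j)) \<circ> (\<lambda>w. restrict (\<lambda>j. \<zeta> j w) T) = (\<lambda>w. u (zsum \<zeta> T w))"
    by (auto simp: zsum_def intro!: arg_cong[of _ _ u] sum.cong)
  ultimately show ?thesis
    using indep_var_lebesgue_integral[of "\<lambda>w. F (restrict (\<lambda>j. \<zeta> j w) S)" "\<lambda>w. u (zsum \<zeta> T w)"] int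
    by (simp add: comp_def)
qed

text \<open>Each difference \<open>f (y + (c + j)) - f y\<close> telescopes into \<open>c + j\<close> unit shifts of \<open>V\<close>.\<close>
lemma abs_expectation_increments_le:
  fixes V :: "'a \<Rightarrow> nat" and X :: "'a \<Rightarrow> 'b::countable"
    and a :: "'b \<Rightarrow> real" and n c b :: "'b \<Rightarrow> nat" and d :: "'a \<Rightarrow> real"
  assumes V: "V \<in> measurable M (count_space UNIV)" and X: "X \<in> measurable M (count_space UNIV)"
    and f: "\<And>k. \<bar>f k\<bar> \<le> K"
    and Y: "\<And>w. w \<in> space M \<Longrightarrow> V w = Y w + b (X w)"
    and d: "integrable M d"
      "\<And>w. w \<in> space M \<Longrightarrow> \<bar>a (X w)\<bar> * (real (n (X w)) * (2 * real (c (X w)) + real (n (X w)) - 1) / 2) \<le> d w"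
  shows "integrable M (\<lambda>w. a (X w) * (\<Sum>j<n (X w). f (Y w + (c (X w) + j)) - f (Y w)))"
    and "\<bar>expectation (\<lambda>w. a (X w) * (\<Sum>j<n (X w). f (Y w + (c (X w) + j)) - f (Y w)))\<bar>
      \<le> K * expectation (\<lambda>w. d w * shiftD M V X w)"
proof -
  \<comment> \<open>At \<open>k = V w\<close> the argument \<open>k - b x\<close> is
    \<open>Y w\<close>, and at \<open>k = Suc (V w)\<close> it is \<open>Suc (Y w)\<close>. A unit
    step in \<open>k\<close> therefore telescopes each inner sum.\<close>
  define H where "H x k = a x * (\<Sum>j<n x. \<Sum>s<c x + j. f (k - b x + s))" for x k
  define e where "e x = K * (\<bar>a x\<bar> * (real (n x) * (2 * real (c x) + real (n x) - 1) / 2))" for x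
  have K: "0 \<le> K"
    using f[of 0] by linarith
  have H: "\<bar>H x k\<bar> \<le> e x" for x k
  proof -
    have "\<bar>\<Sum>j<n x. \<Sum>s<c x + j. f (k - b x + s)\<bar> \<le> (\<Sum>j<n x. \<Sum>s<c x + j. K)"
      by (intro order.trans[OF sum_abs] sum_mono f)
    also have "\<dots> = K * (\<Sum>j<n x. real (c x + j))"
      by (simp add: sum_distrib_left mult.commute)
    finally show ?thesis
      unfolding sum_shifted_count H_def e_def abs_mult mult.left_commute[of K "\<bar>a x\<bar>"]
      by (rule mult_left_mono) simp
  qed
  have em: "(\<lambda>w. e (X w)) \<in> borel_measurable M"
    by (rule measurable_compose[OF X]) simp
  have e0: "0 \<le> e x" for x
    using order.trans[OF abs_ge_zero H] .
  have ed: "e (X w) \<le> K * d w" if "w \<in> space M" for w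
    unfolding e_def by (intro mult_left_mono d(2) that K)
  have ei: "integrable M (\<lambda>w. e (X w))"
    using ed e0 by (intro Bochner_Integration.integrable_bound[OF _ em, of "\<lambda>w. K * d w"])
      (auto simp: d(1) intro!: AE_I2 order.trans[OF _ abs_ge_self])
  have eq: "H (X w) (Suc (V w)) - H (X w) (V w)
      = a (X w) * (\<Sum>j<n (X w). f (Y w + (c (X w) + j)) - f (Y w))" if "w \<in> space M" for w
  proof -
    have "(\<Sum>s<m. f (Suc (V w) - b (X w) + s)) - (\<Sum>s<m. f (V w - b (X w) + s)) = f (Y w + m) - f (Y w)" for m
      using sum_lessThan_telescope[of "\<lambda>s. f (Y w + s)" m] Y[OF that] by (simp add: sum_subtractf)
    then show ?thesis
      unfolding H_def right_diff_distrib[symmetric] sum_subtractf[symmetric] by simp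
  qed
  have ieq: "integrable M (\<lambda>w. H (X w) (Suc (V w)) - H (X w) (V w)) \<longleftrightarrow>
      integrable M (\<lambda>w. a (X w) * (\<Sum>j<n (X w). f (Y w + (c (X w) + j)) - f (Y w)))"
    by (intro Bochner_Integration.integrable_cong eq refl)
  then show "integrable M (\<lambda>w. a (X w) * (\<Sum>j<n (X w). f (Y w + (c (X w) + j)) - f (Y w)))"
    using abs_expectation_shift_le(1)[of V X H e, OF V X H ei] by simp
  have "expectation (\<lambda>w. a (X w) * (\<Sum>j<n (X w). f (Y w + (c (X w) + j)) - f (Y w)))
      = expectation (\<lambda>w. H (X w) (Suc (V w)) - H (X w) (V w))"
    by (intro Bochner_Integration.integral_cong refl eq[symmetric])
  also have "\<bar>\<dots>\<bar> \<le> expectation (\<lambda>w. e (X w) * shiftD M V X w)"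
    by (rule abs_expectation_shift_le(2)[of V X H e, OF V X H ei])
  also have "\<dots> \<le> expectation (\<lambda>w. K * (d w * shiftD M V X w))"
  proof (intro integral_mono integrable_mult_shiftD[of V X] integrable_mult_right V X ei d(1))
    fix w assume "w \<in> space M"
    then show "e (X w) * shiftD M V X w \<le> K * (d w * shiftD M V X w)"
      using mult_right_mono[OF ed shiftD_nonneg[of V X w, OF V X]] by (simp add: mult.assoc)
  qed
  finally show "\<bar>expectation (\<lambda>w. a (X w) * (\<Sum>j<n (X w). f (Y w + (c (X w) + j)) - f (Y w)))\<bar>
      \<le> K * expectation (\<lambda>w. d w * shiftD M V X w)"
    by simp
qed

end

section \<open>Expansion under local dependence\<close>

locale local_dependence = prob_space M for M :: "'a measure" +
  fixes J :: "nat set" and \<zeta> :: "nat \<Rightarrow> 'a \<Rightarrow> nat" and A B :: "nat \<Rightarrow> nat set"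
  assumes finite_J: "finite J"
    and meas: "\<And>i. i \<in> J \<Longrightarrow> \<zeta> i \<in> measurable M (count_space UNIV)"
    and mom3: "\<And>i. i \<in> J \<Longrightarrow> integrable M (\<lambda>w. real (\<zeta> i w) ^ 3)"
    and AB: "\<And>i. i \<in> J \<Longrightarrow> i \<in> A i \<and> A i \<subseteq> B i \<and> B i \<subseteq> J"
    and indA: "\<And>i. i \<in> J \<Longrightarrow> indep_var
                   (PiM {i} (\<lambda>_. count_space UNIV)) (\<lambda>w. restrict (\<lambda>j. \<zeta> j w) {i})
                   (PiM (J - A i) (\<lambda>_. count_space UNIV)) (\<lambda>w. restrict (\<lambda>j. \<zeta> j w) (J - A i))"
    and indB: "\<And>i. i \<in> J \<Longrightarrow> indep_var
                   (PiM (A i) (\<lambda>_. count_space UNIV)) (\<lambda>w. restrict (\<lambda>j. \<zeta> j w) (A i))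
                   (PiM (J - B i) (\<lambda>_. count_space UNIV)) (\<lambda>w. restrict (\<lambda>j. \<zeta> j w) (J - B i))"
begin

abbreviation V :: "'a \<Rightarrow> nat" where "V \<equiv> zsum \<zeta> J"
abbreviation Z :: "nat set \<Rightarrow> 'a \<Rightarrow> real" where "Z S w \<equiv> real (zsum \<zeta> S w)"
abbreviation x :: "nat \<Rightarrow> 'a \<Rightarrow> real" where "x i w \<equiv> real (\<zeta> i w)"

lemma subsets:
  assumes "i \<in> J"
  shows "i \<in> A i" "A i \<subseteq> B i" "A i \<subseteq> J" "B i \<subseteq> J" "finite (A i)" "finite (B i)"
proof -
  show "i \<in> A i" "A i \<subseteq> B i" "A i \<subseteq> J" "B i \<subseteq> J"
    using AB[OF assms] by auto
  then show "finite (A i)" "finite (B i)"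
    using finite_J by (blast intro: finite_subset)+
qed

section \<open>Measurability and integrability from third moments\<close>

lemma zsum_meas: "S \<subseteq> J \<Longrightarrow> zsum \<zeta> S \<in> measurable M (count_space UNIV)"
  by (intro measurable_zsum meas finite_subset[OF _ finite_J]) auto

lemma Z_meas: "S \<subseteq> J \<Longrightarrow> (\<lambda>w. u (zsum \<zeta> S w)) \<in> borel_measurable M" for u :: "nat \<Rightarrow> real"
  by (rule measurable_compose[OF zsum_meas]) auto

lemma x_meas: "i \<in> J \<Longrightarrow> x i \<in> borel_measurable M"
  by (rule measurable_compose[OF meas]) auto

lemma zsum_mono: "S \<subseteq> T \<Longrightarrow> T \<subseteq> J \<Longrightarrow> zsum \<zeta> S w \<le> zsum \<zeta> T w"
  unfolding zsum_def using finite_J by (intro sum_mono2) (auto intro: finite_subset)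

lemma le_zsum: "i \<in> S \<Longrightarrow> S \<subseteq> J \<Longrightarrow> \<zeta> i w \<le> zsum \<zeta> S w"
  unfolding zsum_def using finite_J by (intro member_le_sum) (auto intro: finite_subset)

text \<open>The sum is at most \<open>card J\<close> times its largest term, whose cube is one of
  the summands on the right.\<close>

lemma V_cube_le: "Z J w ^ 3 \<le> real (card J) ^ 3 * (\<Sum>i\<in>J. x i w ^ 3)"
proof (cases "J = {}")
  case False
  define k where "k = Max ((\<lambda>i. \<zeta> i w) ` J)"
  have k: "\<zeta> i w \<le> k" if "i \<in> J" for i
    using finite_J that by (simp add: k_def)
  have "k \<in> (\<lambda>i. \<zeta> i w) ` J"
    unfolding k_def using finite_J False by (intro Max_in) auto
  then obtain m where m: "m \<in> J" "k = \<zeta> m w"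
    by auto
  have "zsum \<zeta> J w \<le> card J * k"
    unfolding zsum_def using sum_bounded_above[of J "\<lambda>i. \<zeta> i w" k] k by simp
  then have "Z J w \<le> real (card J) * real k"
    using of_nat_mono by fastforce
  then have "Z J w ^ 3 \<le> (real (card J) * real k) ^ 3"
    by (intro power_mono) auto
  also have "\<dots> \<le> real (card J) ^ 3 * (\<Sum>i\<in>J. x i w ^ 3)"
    unfolding power_mult_distrib m using m finite_J by (intro mult_left_mono member_le_sum) auto
  finally show ?thesis .
qed (simp add: zsum_def)

lemma V_cube_int: "integrable M (\<lambda>w. (1 + Z J w) ^ 3)"
proof (rule Bochner_Integration.integrable_bound)
  show "integrable M (\<lambda>w. 8 + 8 * (real (card J) ^ 3 * (\<Sum>i\<in>J. x i w ^ 3)))"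
    by (intro Bochner_Integration.integrable_add integrable_mult_right
      Bochner_Integration.integrable_sum mom3) auto
  show "(\<lambda>w. (1 + Z J w) ^ 3) \<in> borel_measurable M"
    using Z_meas[of J real] by measurable
  have "(1 + Z J w) ^ 3 \<le> 8 + 8 * (real (card J) ^ 3 * (\<Sum>i\<in>J. x i w ^ 3))" for w
  proof -
    have "(1 + Z J w) ^ 3 \<le> 8 + 8 * Z J w ^ 3"
    proof (cases "zsum \<zeta> J w = 0")
      case False
      then have "(1 + Z J w) ^ 3 \<le> (2 * Z J w) ^ 3"
        by (intro power_mono) auto
      then show ?thesis
        by (simp add: power_mult_distrib)
    qed simp
    then show ?thesis
      using V_cube_le[of w] by simp
  qed
  then show "AE w in M. norm ((1 + Z J w) ^ 3) \<le> norm (8 + 8 * (real (card J) ^ 3 * (\<Sum>i\<in>J. x i w ^ 3)))"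
    by (auto intro!: AE_I2 order.trans[OF _ abs_ge_self])
qed

text \<open>The unbounded products below have at most three factors of linear growth in
  \<open>V\<close>. Shorter products are padded with the constant \<open>1\<close>.\<close>

lemma integrable_prod3:
  assumes m: "f \<in> borel_measurable M" "g \<in> borel_measurable M" "h \<in> borel_measurable M"
    and b: "\<And>w. \<bar>f w\<bar> \<le> c * (1 + Z J w)" "\<And>w. \<bar>g w\<bar> \<le> d * (1 + Z J w)" "\<And>w. \<bar>h w\<bar> \<le> e * (1 + Z J w)"
  shows "integrable M (\<lambda>w. f w * g w * h w)"
proof (rule Bochner_Integration.integrable_bound)
  show "integrable M (\<lambda>w. c * d * e * (1 + Z J w) ^ 3)"
    by (intro integrable_mult_right V_cube_int)
  show "(\<lambda>w. f w * g w * h w) \<in> borel_measurable M"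
    using m by measurable
  have "\<bar>f w * g w * h w\<bar> \<le> (c * (1 + Z J w)) * (d * (1 + Z J w)) * (e * (1 + Z J w))" for w
    unfolding abs_mult
    using order.trans[OF abs_ge_zero b(1)[of w]] order.trans[OF abs_ge_zero b(2)[of w]]
      order.trans[OF abs_ge_zero b(3)[of w]]
    by (intro mult_mono b) auto
  then show "AE w in M. norm (f w * g w * h w) \<le> norm (c * d * e * (1 + Z J w) ^ 3)"
    by (intro AE_I2) (auto simp: power3_eq_cube mult_ac intro: order.trans[OF _ abs_ge_self])
qed

lemma
  assumes "i \<in> J" "S \<subseteq> J" "T \<subseteq> J"
  shows Z_int: "integrable M (Z S)"
    and x_int: "integrable M (x i)"
    and xZ_int: "integrable M (\<lambda>w. x i w * Z S w)"
    and ZZ_int: "integrable M (\<lambda>w. Z S w * Z T w)"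
    and xZ1_int: "integrable M (\<lambda>w. x i w * (Z S w - 1))"
proof -
  have S: "\<bar>Z S w\<bar> \<le> 1 * (1 + Z J w)" and T: "\<bar>Z T w\<bar> \<le> 1 * (1 + Z J w)"
    and i: "\<bar>x i w\<bar> \<le> 1 * (1 + Z J w)" and o: "\<bar>1 :: real\<bar> \<le> 1 * (1 + Z J w)"
    and S1: "\<bar>Z S w - 1\<bar> \<le> 1 * (1 + Z J w)" for w
    using zsum_mono[OF assms(2) order.refl, of w] zsum_mono[OF assms(3) order.refl, of w]
      le_zsum[OF assms(1) order.refl, of w] by auto
  have m: "Z S \<in> borel_measurable M" "Z T \<in> borel_measurable M" "x i \<in> borel_measurable M"
    "(\<lambda>w. Z S w - 1) \<in> borel_measurable M"
    by (rule Z_meas[OF assms(2), of real] Z_meas[OF assms(3), of real] x_meas[OF assms(1)]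
      Z_meas[OF assms(2), of "\<lambda>n. real n - 1"])+
  show "integrable M (Z S)"
    using integrable_prod3[OF m(1) _ _ S o o] by simp
  show "integrable M (x i)"
    using integrable_prod3[OF m(3) _ _ i o o] by simp
  show "integrable M (\<lambda>w. x i w * Z S w)"
    using integrable_prod3[OF m(3,1) _ i S o] by simp
  show "integrable M (\<lambda>w. Z S w * Z T w)"
    using integrable_prod3[OF m(1,2) _ S T o] by simp
  show "integrable M (\<lambda>w. x i w * (Z S w - 1))"
    using integrable_prod3[OF m(3,4) _ i S1 o] by simp
qed

lemma bounded_int:
  fixes u :: "nat \<Rightarrow> real"
  assumes "S \<subseteq> J" "\<And>k. \<bar>u k\<bar> \<le> G"
  shows "integrable M (\<lambda>w. u (zsum \<zeta> S w))"
  by (rule integrable_const_bound[OF _ Z_meas[OF assms(1)], of _ G]) (simp add: assms(2))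

lemma mult_bounded_int:
  fixes u :: "nat \<Rightarrow> real"
  assumes "integrable M f" "S \<subseteq> J" "\<And>k. \<bar>u k\<bar> \<le> G"
  shows "integrable M (\<lambda>w. f w * u (zsum \<zeta> S w))"
proof (rule Bochner_Integration.integrable_bound[of _ "\<lambda>w. f w * G"])
  show "integrable M (\<lambda>w. f w * G)"
    using assms by simp
  show "(\<lambda>w. f w * u (zsum \<zeta> S w)) \<in> borel_measurable M"
    using assms(1) Z_meas[OF assms(2), of u] by auto
  have "norm (f w * u (zsum \<zeta> S w)) \<le> norm (f w * G)" for w
    using order.trans[OF assms(3) abs_ge_self, of "zsum \<zeta> S w"] by (simp add: abs_mult mult_left_mono)
  then show "AE w in M. norm (f w * u (zsum \<zeta> S w)) \<le> norm (f w * G)"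
    by simp
qed

text \<open>\<open>W i\<close> is independent of \<open>\<zeta> i\<close>, and \<open>Y i\<close> of
  the whole family on \<open>A i\<close>.\<close>

abbreviation W :: "nat \<Rightarrow> 'a \<Rightarrow> nat" where "W i \<equiv> zsum \<zeta> (J - A i)"
abbreviation Y :: "nat \<Rightarrow> 'a \<Rightarrow> nat" where "Y i \<equiv> zsum \<zeta> (J - B i)"

lemma V_eq_W: "i \<in> J \<Longrightarrow> V w = W i w + zsum \<zeta> (A i) w"
  using zsum_split[OF finite_J subsets(3)] .

lemma V_eq_Y: "i \<in> J \<Longrightarrow> V w = Y i w + zsum \<zeta> (B i) w"
  using zsum_split[OF finite_J subsets(4)] .

lemma W_eq_Y: "i \<in> J \<Longrightarrow> W i w = Y i w + (zsum \<zeta> (B i) w - zsum \<zeta> (A i) w)"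
  using V_eq_Y[of i w] V_eq_W[of i w] zsum_mono[OF subsets(2,4), of i w] by simp

lemma indA_mult:
  assumes "i \<in> J" "integrable M (\<lambda>w. u (W i w))"
  shows "expectation (\<lambda>w. x i w * u (W i w)) = expectation (x i) * expectation (\<lambda>w. u (W i w))"
proof -
  have F: "(\<lambda>f. real (f i)) \<in> borel_measurable (PiM {i} (\<lambda>_. count_space UNIV))"
    by (rule measurable_compose[OF measurable_component_singleton]) auto
  show ?thesis
    using indep_restrict_expectation_mult[OF indA[OF assms(1)] F, of u] assms finite_J
      x_int[OF assms(1) assms(1)[THEN subsets(3)] assms(1)[THEN subsets(3)]]
    by simp
qed

text \<open>A function of the pair covers the three weights of the second-order expansion: the sum
  over \<open>A i\<close>, its product with \<open>\<zeta> i\<close>, and \<open>\<zeta> i\<close>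
  times that sum minus one.\<close>

lemma indB_mult:
  fixes h :: "nat \<times> nat \<Rightarrow> real"
  assumes "i \<in> J" and "integrable M (\<lambda>w. h (\<zeta> i w, zsum \<zeta> (A i) w))" "integrable M (\<lambda>w. u (Y i w))"
  shows "expectation (\<lambda>w. h (\<zeta> i w, zsum \<zeta> (A i) w) * u (Y i w))
    = expectation (\<lambda>w. h (\<zeta> i w, zsum \<zeta> (A i) w)) * expectation (\<lambda>w. u (Y i w))"
proof -
  let ?P = "PiM (A i) (\<lambda>_. count_space UNIV) :: (nat \<Rightarrow> nat) measure"
  have "(\<lambda>f. f i) \<in> measurable ?P (count_space UNIV)"
    by (rule measurable_component_singleton) (rule subsets(1)[OF assms(1)])
  moreover have "(\<lambda>f. zsum (\<lambda>j f. f j) (A i) f) \<in> measurable ?P (count_space UNIV)"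
    by (intro measurable_zsum subsets(5) assms(1) measurable_component_singleton)
  ultimately have "(\<lambda>f. (f i, zsum (\<lambda>j f. f j) (A i) f)) \<in> measurable ?P (count_space UNIV)"
    by (rule measurable_count_space_Pair)
  from measurable_compose[OF this, of h borel]
  have F: "(\<lambda>f. h (f i, \<Sum>j\<in>A i. f j)) \<in> borel_measurable ?P"
    by (simp add: zsum_def)
  have eq: "h (restrict (\<lambda>j. \<zeta> j w) (A i) i, \<Sum>j\<in>A i. restrict (\<lambda>j. \<zeta> j w) (A i) j)
      = h (\<zeta> i w, zsum \<zeta> (A i) w)" for w
    using subsets(1)[OF assms(1)] by (simp add: zsum_def)
  show ?thesis
    using indep_restrict_expectation_mult[OF indB[OF assms(1)] F, of u] assms(2,3) finite_J
    unfolding eq by simp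
qed

lemma expectation_V: "expectation (Z J) = (\<Sum>i\<in>J. expectation (x i))"
  unfolding zsum_def of_nat_sum
  by (rule Bochner_Integration.integral_sum) (rule x_int[OF _ empty_subsetI empty_subsetI])

text \<open>The variance is the sum of the covariances of \<open>\<zeta> i\<close> with
  \<open>V\<close>; the part \<open>W i\<close> of \<open>V\<close> contributes nothing by
  independence.\<close>

lemma variance_V:
  "variance (Z J) = (\<Sum>i\<in>J. expectation (\<lambda>w. x i w * Z (A i) w) - expectation (x i) * expectation (Z (A i)))"
proof -
  have V2: "(Z J w)\<^sup>2 = (\<Sum>i\<in>J. x i w * Z J w)" for w
    by (simp add: zsum_def power2_eq_square sum_distrib_right)
  have t: "expectation (\<lambda>w. x i w * Z J w) = expectation (\<lambda>w. x i w * Z (A i) w)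
      - expectation (x i) * expectation (Z (A i)) + expectation (x i) * expectation (Z J)" if i: "i \<in> J" for i
  proof -
    note s = subsets(3)[OF i]
    have W: "Z (J - A i) = (\<lambda>w. Z J w - Z (A i) w)"
      using V_eq_W[OF i] by auto
    have "expectation (\<lambda>w. x i w * Z J w) = expectation (\<lambda>w. x i w * Z (A i) w + x i w * Z (J - A i) w)"
      using V_eq_W[OF i] by (simp add: algebra_simps)
    also have "\<dots> = expectation (\<lambda>w. x i w * Z (A i) w) + expectation (\<lambda>w. x i w * Z (J - A i) w)"
      using xZ_int[OF i s s] xZ_int[OF i Diff_subset s] by (intro Bochner_Integration.integral_add) auto
    also have "expectation (\<lambda>w. x i w * Z (J - A i) w) = expectation (x i) * expectation (Z (J - A i))"
      by (intro indA_mult i Z_int[OF i _ s]) auto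
    also have "expectation (Z (J - A i)) = expectation (Z J) - expectation (Z (A i))"
      unfolding W using Z_int[OF i s s] Z_int[OF i order.refl s] by (intro Bochner_Integration.integral_diff) auto
    finally show ?thesis
      by (simp add: algebra_simps)
  qed
  have ZJ: "integrable M (Z J)" "integrable M (\<lambda>w. (Z J w)\<^sup>2)"
  proof -
    have "integrable M (Z J) \<and> integrable M (\<lambda>w. (Z J w)\<^sup>2)"
    proof (cases "J = {}")
      case False
      then obtain i where "i \<in> J"
        by auto
      then show ?thesis
        using Z_int[of i J J] ZZ_int[of i J J] by (simp add: power2_eq_square)
    qed (simp add: zsum_def)
    then show "integrable M (Z J)" "integrable M (\<lambda>w. (Z J w)\<^sup>2)"
      by auto
  qed
  have "variance (Z J) = expectation (\<lambda>w. (Z J w)\<^sup>2) - (expectation (Z J))\<^sup>2"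
    by (rule variance_eq[OF ZJ])
  also have "expectation (\<lambda>w. (Z J w)\<^sup>2) = (\<Sum>i\<in>J. expectation (\<lambda>w. x i w * Z J w))"
    unfolding V2 by (rule Bochner_Integration.integral_sum) (auto intro: xZ_int)
  also have "\<dots> = (\<Sum>i\<in>J. expectation (\<lambda>w. x i w * Z (A i) w)
      - expectation (x i) * expectation (Z (A i))) + (expectation (Z J))\<^sup>2"
    by (simp add: t sum.distrib expectation_V sum_distrib_right power2_eq_square)
  finally show ?thesis
    by simp
qed

end

section \<open>First- and second-order bounds for a general function\<close>

context local_dependence
begin

text \<open>The bound \<open>G\<close> serves integrability, and \<open>K\<close> enters the
  estimates. Keeping \<open>K\<close> abstract lets the same two bounds yield the uniform and the
  non-uniform result.\<close>

context
  fixes r p K G :: real and g :: "nat \<Rightarrow> real"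
  assumes p: "0 < p" "p < 1"
    and mean: "r * (1 - p) / p = expectation (Z J)"
    and g_bounded: "\<And>k. \<bar>g k\<bar> \<le> G"
    and g_diff: "\<And>k. 0 < k \<Longrightarrow> \<bar>g (Suc k) - g k\<bar> \<le> K"
begin

text \<open>Mean matching spreads the term with \<open>r\<close> over \<open>J\<close>. Subtracting
  \<open>g (Suc (W i w))\<close> in all three terms changes nothing, since \<open>\<zeta> i\<close>
  and \<open>W i\<close> are independent and the coefficients \<open>p\<close>,
  \<open>1 - p\<close>, \<open>- 1\<close> add to zero.\<close>

lemma stein_expansion:
  "expectation (\<lambda>w. stein_op r p g (V w)) =
    (\<Sum>i\<in>J. p * expectation (x i) * expectation (\<lambda>w. g (Suc (V w)) - g (Suc (W i w)))
      + (1 - p) * expectation (\<lambda>w. x i w * (g (Suc (V w)) - g (Suc (W i w))))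
      - expectation (\<lambda>w. x i w * (g (V w) - g (Suc (W i w)))))"
proof -
  have iV: "integrable M (\<lambda>w. g (Suc (V w)))"
    using bounded_int[of J "\<lambda>k. g (Suc k)" G] g_bounded by simp
  have t: "expectation (\<lambda>w. x i w * g (Suc (V w))) * (1 - p) - expectation (\<lambda>w. x i w * g (V w))
      + p * expectation (x i) * expectation (\<lambda>w. g (Suc (V w)))
    = p * expectation (x i) * expectation (\<lambda>w. g (Suc (V w)) - g (Suc (W i w)))
      + (1 - p) * expectation (\<lambda>w. x i w * (g (Suc (V w)) - g (Suc (W i w))))
      - expectation (\<lambda>w. x i w * (g (V w) - g (Suc (W i w))))"
    and ix: "integrable M (\<lambda>w. x i w * g (Suc (V w)))" "integrable M (\<lambda>w. x i w * g (V w))"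
    if i: "i \<in> J" for i
  proof -
    have xi: "integrable M (x i)"
      by (rule x_int[OF i empty_subsetI empty_subsetI])
    show ix: "integrable M (\<lambda>w. x i w * g (Suc (V w)))" "integrable M (\<lambda>w. x i w * g (V w))"
      using mult_bounded_int[OF xi order.refl, of "\<lambda>k. g (Suc k)" G]
        mult_bounded_int[OF xi order.refl, of g G] g_bounded by auto
    have iW: "integrable M (\<lambda>w. g (Suc (W i w)))" and ixW: "integrable M (\<lambda>w. x i w * g (Suc (W i w)))"
      using bounded_int[of "J - A i" "\<lambda>k. g (Suc k)" G] g_bounded
        mult_bounded_int[OF xi, of "J - A i" "\<lambda>k. g (Suc k)" G] by auto
    have "expectation (\<lambda>w. x i w * g (Suc (W i w))) = expectation (x i) * expectation (\<lambda>w. g (Suc (W i w)))"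
      using indA_mult[OF i, of "\<lambda>k. g (Suc k)"] iW by simp
    then show "expectation (\<lambda>w. x i w * g (Suc (V w))) * (1 - p) - expectation (\<lambda>w. x i w * g (V w))
      + p * expectation (x i) * expectation (\<lambda>w. g (Suc (V w)))
    = p * expectation (x i) * expectation (\<lambda>w. g (Suc (V w)) - g (Suc (W i w)))
      + (1 - p) * expectation (\<lambda>w. x i w * (g (Suc (V w)) - g (Suc (W i w))))
      - expectation (\<lambda>w. x i w * (g (V w) - g (Suc (W i w))))"
      using ix iW ixW iV by (simp add: right_diff_distrib) (simp add: algebra_simps)
  qed
  have rq: "(1 - p) * r = p * expectation (Z J)"
    using mean p by (simp add: field_simps)
  have "stein_op r p g (V w) = (1 - p) * r * g (Suc (V w))
      + (\<Sum>i\<in>J. x i w * g (Suc (V w)) * (1 - p) - x i w * g (V w))" for w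
    by (simp add: stein_op_def zsum_def sum_subtractf sum.distrib sum_distrib_left sum_distrib_right algebra_simps)
  then have "expectation (\<lambda>w. stein_op r p g (V w)) = (1 - p) * r * expectation (\<lambda>w. g (Suc (V w)))
      + (\<Sum>i\<in>J. expectation (\<lambda>w. x i w * g (Suc (V w))) * (1 - p) - expectation (\<lambda>w. x i w * g (V w)))"
    using ix iV by (simp add: Bochner_Integration.integral_sum)
  also have "\<dots> = (\<Sum>i\<in>J. expectation (\<lambda>w. x i w * g (Suc (V w))) * (1 - p) - expectation (\<lambda>w. x i w * g (V w))
      + p * expectation (x i) * expectation (\<lambda>w. g (Suc (V w))))"
    unfolding rq expectation_V by (simp add: sum.distrib sum_distrib_left sum_distrib_right)
  also have "\<dots> = (\<Sum>i\<in>J. p * expectation (x i) * expectation (\<lambda>w. g (Suc (V w)) - g (Suc (W i w)))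
      + (1 - p) * expectation (\<lambda>w. x i w * (g (Suc (V w)) - g (Suc (W i w))))
      - expectation (\<lambda>w. x i w * (g (V w) - g (Suc (W i w)))))"
    by (rule sum.cong[OF refl t])
  finally show ?thesis .
qed

text \<open>Starting from \<open>Suc k\<close> keeps every increment at a positive argument, where
  \<open>g_diff\<close> applies.\<close>

lemma g_lipschitz: "\<bar>g (Suc (k + n)) - g (Suc k)\<bar> \<le> K * real n"
proof (induction n)
  case (Suc n)
  then show ?case
    using g_diff[of "Suc (k + n)"] by (simp add: distrib_left)
qed simp

text \<open>A positive \<open>\<zeta> i w\<close> makes the natural subtraction exact. This is the
  origin of \<open>Z (A i) w - 1\<close> in the bounds; where \<open>\<zeta> i w = 0\<close>, the
  weight \<open>x i w\<close> removes the term.\<close>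

lemma V_diff:
  assumes "i \<in> J" "0 < \<zeta> i w"
  shows "V w = Suc (W i w + (zsum \<zeta> (A i) w - 1))"
  using V_eq_W[OF assms(1), of w] le_zsum[OF subsets(1,3)[OF assms(1)], of w] assms(2) by simp

text \<open>From \<open>Suc (W i w)\<close> it is \<open>zsum \<zeta> (A i) w\<close> steps to
  \<open>Suc (V w)\<close>, and one fewer to \<open>V w\<close> if \<open>\<zeta> i w > 0\<close>;
  apply \<open>g_lipschitz\<close> to each term of \<open>stein_expansion\<close>.\<close>

lemma first_order_bound:
  "\<bar>expectation (\<lambda>w. stein_op r p g (V w))\<bar>
    \<le> K * (\<Sum>i\<in>J. p * expectation (x i) * expectation (Z (A i))
        + (1 - p) * expectation (\<lambda>w. x i w * Z (A i) w)
        + expectation (\<lambda>w. x i w * (Z (A i) w - 1)))"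
proof -
  have t: "\<bar>p * expectation (x i) * expectation (\<lambda>w. g (Suc (V w)) - g (Suc (W i w)))
      + (1 - p) * expectation (\<lambda>w. x i w * (g (Suc (V w)) - g (Suc (W i w))))
      - expectation (\<lambda>w. x i w * (g (V w) - g (Suc (W i w))))\<bar>
    \<le> K * (p * expectation (x i) * expectation (Z (A i))
        + (1 - p) * expectation (\<lambda>w. x i w * Z (A i) w)
        + expectation (\<lambda>w. x i w * (Z (A i) w - 1)))" (is "\<bar>?a + ?b - ?c\<bar> \<le> _")
    if i: "i \<in> J" for i
  proof -
    note s = subsets(3)[OF i]
    have d: "\<bar>g (Suc (V w)) - g (Suc (W i w))\<bar> \<le> K * Z (A i) w" for w
      using g_lipschitz[of "W i w" "zsum \<zeta> (A i) w"] V_eq_W[OF i, of w] by simp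
    have d1: "\<bar>x i w * (g (Suc (V w)) - g (Suc (W i w)))\<bar> \<le> K * (x i w * Z (A i) w)" for w
      using mult_left_mono[OF d[of w], of "x i w"] by (simp add: abs_mult mult_ac)
    have d2: "\<bar>x i w * (g (V w) - g (Suc (W i w)))\<bar> \<le> K * (x i w * (Z (A i) w - 1))" for w
    proof (cases "\<zeta> i w = 0")
      case False
      then have z: "0 < \<zeta> i w" "0 < zsum \<zeta> (A i) w"
        using le_zsum[OF subsets(1)[OF i] s, of w] by auto
      have "\<bar>g (V w) - g (Suc (W i w))\<bar> \<le> K * (Z (A i) w - 1)"
        using g_lipschitz[of "W i w" "zsum \<zeta> (A i) w - 1"] V_diff[OF i z(1)] z(2) by (simp add: of_nat_diff)
      then show ?thesis
        using mult_left_mono[of "\<bar>g (V w) - g (Suc (W i w))\<bar>" "K * (Z (A i) w - 1)" "x i w"]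
        by (simp add: abs_mult mult_ac)
    qed simp
    have e: "\<bar>expectation f\<bar> \<le> K * expectation h"
      if "integrable M h" "\<And>w. \<bar>f w\<bar> \<le> K * h w" for f h :: "'a \<Rightarrow> real"
    proof -
      have "\<bar>expectation f\<bar> \<le> expectation (\<lambda>w. \<bar>f w\<bar>)"
        by (rule integral_abs_bound)
      also have "\<dots> \<le> expectation (\<lambda>w. K * h w)"
        using that(1) by (intro integral_mono' that(2) order.trans[OF abs_ge_zero that(2)]) simp
      finally have "\<bar>expectation f\<bar> \<le> expectation (\<lambda>w. K * h w)" .
      then show ?thesis
        by simp
    qed
    have "\<bar>?a\<bar> \<le> p * expectation (x i) * (K * expectation (Z (A i)))"
      unfolding abs_mult using p e[OF Z_int[OF i s s] d]
      by (intro mult_mono) (auto intro!: mult_nonneg_nonneg)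
    moreover have "\<bar>?b\<bar> \<le> (1 - p) * (K * expectation (\<lambda>w. x i w * Z (A i) w))"
      unfolding abs_mult using p e[OF xZ_int[OF i s s] d1] by (intro mult_mono) auto
    moreover have "\<bar>?c\<bar> \<le> K * expectation (\<lambda>w. x i w * (Z (A i) w - 1))"
      by (rule e[OF xZ1_int[OF i s s] d2])
    ultimately show ?thesis
      by (simp add: algebra_simps)
  qed
  show ?thesis
    unfolding stein_expansion sum_distrib_left
    by (intro order.trans[OF sum_abs] sum_mono t)
qed

text \<open>Each increment of \<open>g\<close> is compared with \<open>f (Y i w)\<close>.
  Independence factors out the expectation of \<open>f (Y i w)\<close> with coefficient
  \<open>c i\<close>, and replacing it by that of \<open>f (V w)\<close>, common to all
  \<open>i\<close>, lets the coefficients cancel.\<close>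

lemma second_order_bound:
  assumes var: "r * (1 - p) / p\<^sup>2 = variance (Z J)"
  shows "\<bar>expectation (\<lambda>w. stein_op r p g (V w))\<bar> \<le> K *
    (p * (\<Sum>i\<in>J. expectation (x i) * expectation (\<lambda>w. Z (A i) w * (2 * Z (B i) w - Z (A i) w - 1)
        * shiftD M V (\<lambda>v. (zsum \<zeta> (A i) v, zsum \<zeta> (B i) v)) w))
    + (1 - p) * (\<Sum>i\<in>J. expectation (\<lambda>w. x i w * Z (A i) w * (2 * Z (B i) w - Z (A i) w - 1)
        * shiftD M V (\<lambda>v. (\<zeta> i v, zsum \<zeta> (A i) v, zsum \<zeta> (B i) v)) w))
    + (\<Sum>i\<in>J. \<bar>p * expectation (x i) * expectation (Z (A i)) + (1 - p) * expectation (\<lambda>w. x i w * Z (A i) w)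
        - expectation (\<lambda>w. x i w * (Z (A i) w - 1))\<bar> * expectation (\<lambda>w. Z (B i) w * shiftD M V (zsum \<zeta> (B i)) w))
    + (\<Sum>i\<in>J. expectation (\<lambda>w. x i w * (Z (A i) w - 1) * (2 * Z (B i) w - Z (A i) w - 2)
        * shiftD M V (\<lambda>v. (\<zeta> i v, zsum \<zeta> (A i) v, zsum \<zeta> (B i) v)) w)))"
proof -
  \<comment> \<open>The offset by one keeps \<open>f\<close> among increments at positive arguments,
    also for \<open>k = 0\<close>.\<close>
  define f where "f k = g (Suc (Suc k)) - g (Suc k)" for k
  have f: "\<bar>f k\<bar> \<le> K" for k
    unfolding f_def by (rule g_diff) simp
  have K: "0 \<le> K"
    using f[of 0] by linarith
  define c where "c i = p * expectation (x i) * expectation (Z (A i)) + (1 - p) * expectation (\<lambda>w. x i w * Z (A i) w)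
        - expectation (\<lambda>w. x i w * (Z (A i) w - 1))" for i
  define T1 where "T1 i = expectation (\<lambda>w. Z (A i) w * (2 * Z (B i) w - Z (A i) w - 1)
        * shiftD M V (\<lambda>v. (zsum \<zeta> (A i) v, zsum \<zeta> (B i) v)) w)" for i
  define T2 where "T2 i = expectation (\<lambda>w. x i w * Z (A i) w * (2 * Z (B i) w - Z (A i) w - 1)
        * shiftD M V (\<lambda>v. (\<zeta> i v, zsum \<zeta> (A i) v, zsum \<zeta> (B i) v)) w)" for i
  define T3 where "T3 i = expectation (\<lambda>w. x i w * (Z (A i) w - 1) * (2 * Z (B i) w - Z (A i) w - 2)
        * shiftD M V (\<lambda>v. (\<zeta> i v, zsum \<zeta> (A i) v, zsum \<zeta> (B i) v)) w)" for i
  define T4 where "T4 i = expectation (\<lambda>w. Z (B i) w * shiftD M V (zsum \<zeta> (B i)) w)" for i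
  \<comment> \<open>The remainder when \<open>n\<close> increments beyond \<open>W i w\<close> are
    all replaced by \<open>f (Y i w)\<close>; the offset is the distance from \<open>Y i w\<close>
    to \<open>W i w\<close>.\<close>
  define R where "R n i w = (\<Sum>j<n. f (Y i w + ((zsum \<zeta> (B i) w - zsum \<zeta> (A i) w) + j)) - f (Y i w))" for n i w
  have R: "g (Suc (W i w + n)) - g (Suc (W i w)) = real n * f (Y i w) + R n i w" if i: "i \<in> J" for i n w
    using sum_lessThan_telescope[of "\<lambda>j. g (Suc (W i w + j))" n]
    by (simp add: R_def sum_subtractf W_eq_Y[OF i, of w] f_def add.assoc)
  \<comment> \<open>\<open>c i\<close> is the mean of \<open>\<zeta> i\<close> minus
    \<open>p\<close> times its covariance with the sum over \<open>A i\<close>. The total is the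
    mean of \<open>V\<close> minus \<open>p\<close> times its variance, zero by the two matching
    conditions.\<close>
  have c_sum: "(\<Sum>i\<in>J. c i) = 0"
  proof -
    have "c i = expectation (x i) - p * (expectation (\<lambda>w. x i w * Z (A i) w) - expectation (x i) * expectation (Z (A i)))"
      if i: "i \<in> J" for i
      using xZ_int[OF i subsets(3,3)[OF i]] x_int[OF i subsets(3,3)[OF i]]
      by (simp add: c_def right_diff_distrib) (simp add: algebra_simps)
    then have "(\<Sum>i\<in>J. c i) = expectation (Z J) - p * variance (Z J)"
      unfolding variance_V by (simp add: expectation_V sum_subtractf sum_distrib_left right_diff_distrib)
    also have "\<dots> = 0"
    proof -
      have "p * variance (Z J) = r * (1 - p) / p"
        using p unfolding var[symmetric] by (simp add: power2_eq_square)
      then show ?thesis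
        using mean by simp
    qed
    finally show ?thesis .
  qed
  have t: "\<bar>p * expectation (x i) * expectation (\<lambda>w. g (Suc (V w)) - g (Suc (W i w)))
      + (1 - p) * expectation (\<lambda>w. x i w * (g (Suc (V w)) - g (Suc (W i w))))
      - expectation (\<lambda>w. x i w * (g (V w) - g (Suc (W i w))))
      - c i * expectation (\<lambda>w. f (V w))\<bar>
      \<le> K * (p * (expectation (x i) * T1 i) + (1 - p) * T2 i + \<bar>c i\<bar> * T4 i + T3 i)"
    (is "\<bar>?L - _\<bar> \<le> ?U") if i: "i \<in> J" for i
  proof -
    note sA = subsets(3)[OF i] and sB = subsets(4)[OF i]
    have AB_le: "zsum \<zeta> (A i) w \<le> zsum \<zeta> (B i) w" for w
      using zsum_mono[OF subsets(2,4)[OF i]] .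
    have xA: "\<zeta> i w \<le> zsum \<zeta> (A i) w" for w
      using le_zsum[OF subsets(1)[OF i] sA] .
    have BJ: "zsum \<zeta> (B i) w \<le> V w" for w
      by (rule zsum_mono[OF sB order.refl])
    have mAB: "(\<lambda>v. (zsum \<zeta> (A i) v, zsum \<zeta> (B i) v)) \<in> measurable M (count_space UNIV)"
      by (intro measurable_count_space_Pair zsum_meas sA sB)
    have mxAB: "(\<lambda>v. (\<zeta> i v, zsum \<zeta> (A i) v, zsum \<zeta> (B i) v)) \<in> measurable M (count_space UNIV)"
      by (intro measurable_count_space_Pair zsum_meas meas i sA sB)
    have mV: "V \<in> measurable M (count_space UNIV)"
      by (rule zsum_meas) simp
    have bm: "x i \<in> borel_measurable M" "Z (A i) \<in> borel_measurable M" "Z (B i) \<in> borel_measurable M"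
      using x_meas[OF i] Z_meas[OF sA, of real] Z_meas[OF sB, of real] .
    have b: "\<bar>x i w\<bar> \<le> 1 * (1 + Z J w)" "\<bar>Z (A i) w\<bar> \<le> 1 * (1 + Z J w)" "\<bar>Z (A i) w - 1\<bar> \<le> 1 * (1 + Z J w)"
      "\<bar>1 :: real\<bar> \<le> 1 * (1 + Z J w)" "\<bar>2 * Z (B i) w - Z (A i) w - 1\<bar> \<le> 3 * (1 + Z J w)"
      "\<bar>2 * Z (B i) w - Z (A i) w - 2\<bar> \<le> 3 * (1 + Z J w)" for w
      using xA[of w] AB_le[of w] BJ[of w] by (auto simp: abs_le_iff)
    have d1: "integrable M (\<lambda>w. Z (A i) w * (2 * Z (B i) w - Z (A i) w - 1))"
      using integrable_prod3[OF borel_measurable_const _ _ b(4,2,5)] bm by simp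
    have d2: "integrable M (\<lambda>w. x i w * Z (A i) w * (2 * Z (B i) w - Z (A i) w - 1))"
      using integrable_prod3[OF _ _ _ b(1,2,5)] bm by simp
    have d3: "integrable M (\<lambda>w. x i w * (Z (A i) w - 1) * (2 * Z (B i) w - Z (A i) w - 2))"
      using integrable_prod3[OF _ _ _ b(1,3,6)] bm by simp
    have d4: "integrable M (Z (B i))"
      by (rule Z_int[OF i sB sB])
    have nonneg: "0 \<le> Z (A i) w * (2 * Z (B i) w - Z (A i) w - 1)" for w
    proof (cases "zsum \<zeta> (A i) w = 0")
      case False
      then show ?thesis
        using AB_le[of w] by (intro mult_nonneg_nonneg) auto
    qed simp
    \<comment> \<open>The exact shift count has a factor \<open>1 / 2\<close>, dropped here because
      the count is nonnegative.\<close>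
    have ineq1: "Z (A i) w * (2 * real (zsum \<zeta> (B i) w - zsum \<zeta> (A i) w) + Z (A i) w - 1) / 2
        \<le> Z (A i) w * (2 * Z (B i) w - Z (A i) w - 1)" for w
    proof -
      have "2 * real (zsum \<zeta> (B i) w - zsum \<zeta> (A i) w) + Z (A i) w - 1 = 2 * Z (B i) w - Z (A i) w - 1"
        using AB_le[of w] by (simp add: of_nat_diff)
      then show ?thesis
        using nonneg[of w] by (simp only:)
    qed
    have ineq3: "x i w * (real (zsum \<zeta> (A i) w - 1) * (2 * real (zsum \<zeta> (B i) w - zsum \<zeta> (A i) w)
          + real (zsum \<zeta> (A i) w - 1) - 1) / 2)
        \<le> x i w * (Z (A i) w - 1) * (2 * Z (B i) w - Z (A i) w - 2)" for w
    proof (cases "\<zeta> i w = 0")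
      case False
      then have pos: "0 < zsum \<zeta> (A i) w"
        using xA[of w] by simp
      have "0 \<le> (Z (A i) w - 1) * (2 * Z (B i) w - Z (A i) w - 2)"
      \<comment> \<open>At the value one the second factor can be \<open>- 1\<close>, but the first
        is zero.\<close>
      proof (cases "zsum \<zeta> (A i) w = 1")
        case False
        then show ?thesis
          using pos AB_le[of w] by (intro mult_nonneg_nonneg) auto
      qed simp
      then have "(Z (A i) w - 1) * (2 * Z (B i) w - Z (A i) w - 2) / 2
          \<le> (Z (A i) w - 1) * (2 * Z (B i) w - Z (A i) w - 2)"
        by simp
      moreover have "real (zsum \<zeta> (A i) w - 1) * (2 * real (zsum \<zeta> (B i) w - zsum \<zeta> (A i) w)
          + real (zsum \<zeta> (A i) w - 1) - 1) = (Z (A i) w - 1) * (2 * Z (B i) w - Z (A i) w - 2)"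
        using pos AB_le[of w] by (simp add: of_nat_diff)
      ultimately show ?thesis
        by (simp add: mult.assoc mult_left_mono del: times_divide_eq_right)
    qed simp
    have E1: "integrable M (\<lambda>w. R (zsum \<zeta> (A i) w) i w)" "\<bar>expectation (\<lambda>w. R (zsum \<zeta> (A i) w) i w)\<bar> \<le> K * T1 i"
      using abs_expectation_increments_le[where V = V and f = f and K = K
          and X = "\<lambda>v. (zsum \<zeta> (A i) v, zsum \<zeta> (B i) v)" and Y = "Y i" and a = "\<lambda>_. 1" and n = fst
          and c = "\<lambda>(s, t). t - s" and b = snd and d = "\<lambda>w. Z (A i) w * (2 * Z (B i) w - Z (A i) w - 1)",
          OF mV mAB f _ d1] V_eq_Y[OF i] ineq1
      by (simp_all add: R_def T1_def)
    have E2: "integrable M (\<lambda>w. x i w * R (zsum \<zeta> (A i) w) i w)"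
        "\<bar>expectation (\<lambda>w. x i w * R (zsum \<zeta> (A i) w) i w)\<bar> \<le> K * T2 i"
      using abs_expectation_increments_le[where V = V and f = f and K = K
          and X = "\<lambda>v. (\<zeta> i v, zsum \<zeta> (A i) v, zsum \<zeta> (B i) v)" and Y = "Y i" and a = "\<lambda>y. real (fst y)"
          and n = "\<lambda>y. fst (snd y)" and c = "\<lambda>y. snd (snd y) - fst (snd y)" and b = "\<lambda>y. snd (snd y)"
          and d = "\<lambda>w. x i w * Z (A i) w * (2 * Z (B i) w - Z (A i) w - 1)",
          OF mV mxAB f _ d2] V_eq_Y[OF i] mult_left_mono[OF ineq1 of_nat_0_le_iff]
      by (simp_all add: R_def T2_def mult.assoc)
    have E3: "integrable M (\<lambda>w. x i w * R (zsum \<zeta> (A i) w - 1) i w)"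
        "\<bar>expectation (\<lambda>w. x i w * R (zsum \<zeta> (A i) w - 1) i w)\<bar> \<le> K * T3 i"
      using abs_expectation_increments_le[where V = V and f = f and K = K
          and X = "\<lambda>v. (\<zeta> i v, zsum \<zeta> (A i) v, zsum \<zeta> (B i) v)" and Y = "Y i" and a = "\<lambda>y. real (fst y)"
          and n = "\<lambda>y. fst (snd y) - 1" and c = "\<lambda>y. snd (snd y) - fst (snd y)" and b = "\<lambda>y. snd (snd y)"
          and d = "\<lambda>w. x i w * (Z (A i) w - 1) * (2 * Z (B i) w - Z (A i) w - 2)",
          OF mV mxAB f _ d3] V_eq_Y[OF i] ineq3
      by (simp_all add: R_def T3_def)
    \<comment> \<open>A single increment with offset the sum over \<open>B i\<close>: for
      \<open>n = 1\<close> the shift count is exactly \<open>c\<close>.\<close>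
    have E4: "\<bar>expectation (\<lambda>w. f (V w) - f (Y i w))\<bar> \<le> K * T4 i"
      using abs_expectation_increments_le(2)[where V = V and f = f and K = K
          and X = "zsum \<zeta> (B i)" and Y = "Y i" and a = "\<lambda>_. 1" and n = "\<lambda>_. 1"
          and c = "\<lambda>y. y" and b = "\<lambda>y. y" and d = "Z (B i)", OF mV zsum_meas[OF sB] f _ d4] V_eq_Y[OF i]
      by (simp add: T4_def)
    have fY: "integrable M (\<lambda>w. f (Y i w))" and fV: "integrable M (\<lambda>w. f (V w))"
      using bounded_int[of _ f K] f by auto
    have m1: "integrable M (\<lambda>w. Z (A i) w * f (Y i w))" and m2: "integrable M (\<lambda>w. x i w * Z (A i) w * f (Y i w))"
      and m3: "integrable M (\<lambda>w. x i w * (Z (A i) w - 1) * f (Y i w))"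
      by (rule mult_bounded_int[OF _ Diff_subset f]; rule Z_int[OF i sA sA] xZ_int[OF i sA sA] xZ1_int[OF i sA sA])+
    have L1: "expectation (\<lambda>w. g (Suc (V w)) - g (Suc (W i w)))
        = expectation (Z (A i)) * expectation (\<lambda>w. f (Y i w)) + expectation (\<lambda>w. R (zsum \<zeta> (A i) w) i w)"
      using R[OF i] m1 E1(1) indB_mult[OF i, of "\<lambda>y. real (snd y)" f] Z_int[OF i sA sA] fY
      by (simp add: V_eq_W[OF i])
    have L2: "expectation (\<lambda>w. x i w * (g (Suc (V w)) - g (Suc (W i w))))
        = expectation (\<lambda>w. x i w * Z (A i) w) * expectation (\<lambda>w. f (Y i w))
          + expectation (\<lambda>w. x i w * R (zsum \<zeta> (A i) w) i w)"
      using R[OF i] m2 E2(1) indB_mult[OF i, of "\<lambda>y. real (fst y) * real (snd y)" f] xZ_int[OF i sA sA] fY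
      by (simp add: V_eq_W[OF i] distrib_left mult.assoc)
    have pt: "x i w * (g (V w) - g (Suc (W i w)))
        = x i w * (Z (A i) w - 1) * f (Y i w) + x i w * R (zsum \<zeta> (A i) w - 1) i w" for w
    proof (cases "\<zeta> i w = 0")
      case False
      then have "0 < zsum \<zeta> (A i) w" "V w = Suc (W i w + (zsum \<zeta> (A i) w - 1))"
        using xA[of w] V_diff[OF i, of w] by auto
      then show ?thesis
        using R[OF i, of w "zsum \<zeta> (A i) w - 1"] by (simp add: of_nat_diff distrib_left mult.assoc)
    qed simp
    have L3: "expectation (\<lambda>w. x i w * (g (V w) - g (Suc (W i w))))
        = expectation (\<lambda>w. x i w * (Z (A i) w - 1)) * expectation (\<lambda>w. f (Y i w))
          + expectation (\<lambda>w. x i w * R (zsum \<zeta> (A i) w - 1) i w)"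
      unfolding pt
      using m3 E3(1) indB_mult[OF i, of "\<lambda>y. real (fst y) * (real (snd y) - 1)" f] xZ1_int[OF i sA sA] fY
      by simp
    \<comment> \<open>The leading terms of \<open>L1\<close>, \<open>L2\<close> and
      \<open>L3\<close> combine to \<open>c i\<close> times the expectation of
      \<open>f (Y i w)\<close>, leaving a difference that \<open>E4\<close> controls.\<close>
    have eq: "?L - c i * expectation (\<lambda>w. f (V w))
        = p * expectation (x i) * expectation (\<lambda>w. R (zsum \<zeta> (A i) w) i w)
          + (1 - p) * expectation (\<lambda>w. x i w * R (zsum \<zeta> (A i) w) i w)
          - c i * expectation (\<lambda>w. f (V w) - f (Y i w))
          - expectation (\<lambda>w. x i w * R (zsum \<zeta> (A i) w - 1) i w)"
      unfolding L1 L2 L3 Bochner_Integration.integral_diff[OF fV fY] c_def by (simp only: algebra_simps)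
    have b1: "\<bar>p * expectation (x i) * expectation (\<lambda>w. R (zsum \<zeta> (A i) w) i w)\<bar> \<le> p * expectation (x i) * (K * T1 i)"
      unfolding abs_mult using p E1(2) by (intro mult_mono) (auto intro!: mult_nonneg_nonneg)
    have b2: "\<bar>(1 - p) * expectation (\<lambda>w. x i w * R (zsum \<zeta> (A i) w) i w)\<bar> \<le> (1 - p) * (K * T2 i)"
      unfolding abs_mult using p E2(2) by (intro mult_mono) auto
    have b4: "\<bar>c i * expectation (\<lambda>w. f (V w) - f (Y i w))\<bar> \<le> \<bar>c i\<bar> * (K * T4 i)"
      unfolding abs_mult using E4 by (intro mult_left_mono) auto
    have U: "?U = p * expectation (x i) * (K * T1 i) + (1 - p) * (K * T2 i) + \<bar>c i\<bar> * (K * T4 i) + K * T3 i"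
      by (simp only: algebra_simps)
    show ?thesis
      unfolding eq U using b1 b2 b4 E3(2) by linarith
  qed
  \<comment> \<open>The subtracted terms share one expectation and cancel in total by
    \<open>c_sum\<close>.\<close>
  have S: "expectation (\<lambda>w. stein_op r p g (V w)) =
    (\<Sum>i\<in>J. p * expectation (x i) * expectation (\<lambda>w. g (Suc (V w)) - g (Suc (W i w)))
      + (1 - p) * expectation (\<lambda>w. x i w * (g (Suc (V w)) - g (Suc (W i w))))
      - expectation (\<lambda>w. x i w * (g (V w) - g (Suc (W i w)))) - c i * expectation (\<lambda>w. f (V w)))"
    unfolding stein_expansion sum_subtractf sum_distrib_right[symmetric] c_sum by simp
  have "\<bar>expectation (\<lambda>w. stein_op r p g (V w))\<bar>
      \<le> (\<Sum>i\<in>J. K * (p * (expectation (x i) * T1 i) + (1 - p) * T2 i + \<bar>c i\<bar> * T4 i + T3 i))"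
    unfolding S
    by (intro order.trans[OF sum_abs] sum_mono t)
  also have "\<dots> = K * (p * (\<Sum>i\<in>J. expectation (x i) * T1 i) + (1 - p) * (\<Sum>i\<in>J. T2 i) + (\<Sum>i\<in>J. \<bar>c i\<bar> * T4 i) + (\<Sum>i\<in>J. T3 i))"
    by (simp only: sum_distrib_left[symmetric] sum.distrib)
  finally show ?thesis
    unfolding T1_def T2_def T3_def T4_def c_def .
qed

end

end

section \<open>Uniform and non-uniform bounds in both matching cases\<close>

theorem theorem3p1:
  fixes M :: "'a measure" and J :: "nat set" and \<zeta> :: "nat \<Rightarrow> 'a \<Rightarrow> nat"
    and A B :: "nat \<Rightarrow> nat set" and r p :: real
  assumes "prob_space M"
    and "finite J" and "0 \<notin> J"
    and meas: "\<And>i. i \<in> J \<Longrightarrow> \<zeta> i \<in> measurable M (count_space UNIV)"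
    and mom3: "\<And>i. i \<in> J \<Longrightarrow> integrable M (\<lambda>w. real (\<zeta> i w) ^ 3)"
    and AB: "\<And>i. i \<in> J \<Longrightarrow> i \<in> A i \<and> A i \<subseteq> B i \<and> B i \<subseteq> J"
    and indA: "\<And>i. i \<in> J \<Longrightarrow> prob_space.indep_var M
                   (PiM {i} (\<lambda>_. count_space UNIV)) (\<lambda>w. restrict (\<lambda>j. \<zeta> j w) {i})
                   (PiM (J - A i) (\<lambda>_. count_space UNIV)) (\<lambda>w. restrict (\<lambda>j. \<zeta> j w) (J - A i))"
    and indB: "\<And>i. i \<in> J \<Longrightarrow> prob_space.indep_var M
                   (PiM (A i) (\<lambda>_. count_space UNIV)) (\<lambda>w. restrict (\<lambda>j. \<zeta> j w) (A i))
                   (PiM (J - B i) (\<lambda>_. count_space UNIV)) (\<lambda>w. restrict (\<lambda>j. \<zeta> j w) (J - B i))"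
    and "r > 1" and "0 < p" and "p < 1"
  shows
   "let q = 1 - p; V = zsum \<zeta> J;
        E = (\<lambda>f. prob_space.expectation M f);
        Z = (\<lambda>S w. real (zsum \<zeta> S w));
        EAg = (\<lambda>z. E (\<lambda>w. stein_op r p (g_sol r p z) (V w)));
        theta = (\<lambda>z. (r + 1) / z * ((1 + 1 / q) * p powr (- (r + 2)) - p powr (- 2)));
        C = 2 * p powr (- (r + 1)) - 1 / p;
        Ua = (\<Sum>i\<in>J. p * E (\<lambda>w. real (\<zeta> i w)) * E (Z (A i))
                   + q * E (\<lambda>w. real (\<zeta> i w) * Z (A i) w)
                   + E (\<lambda>w. real (\<zeta> i w) * (Z (A i) w - 1)));
        Ub = p * (\<Sum>i\<in>J. E (\<lambda>w. real (\<zeta> i w)) *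
                   E (\<lambda>w. Z (A i) w * (2 * Z (B i) w - Z (A i) w - 1)
                          * shiftD M V (\<lambda>v. (zsum \<zeta> (A i) v, zsum \<zeta> (B i) v)) w))
           + q * (\<Sum>i\<in>J. E (\<lambda>w. real (\<zeta> i w) * Z (A i) w * (2 * Z (B i) w - Z (A i) w - 1)
                          * shiftD M V (\<lambda>v. (\<zeta> i v, zsum \<zeta> (A i) v, zsum \<zeta> (B i) v)) w))
           + (\<Sum>i\<in>J. \<bar>p * E (\<lambda>w. real (\<zeta> i w)) * E (Z (A i))
                        + q * E (\<lambda>w. real (\<zeta> i w) * Z (A i) w)
                        - E (\<lambda>w. real (\<zeta> i w) * (Z (A i) w - 1))\<bar>
                   * E (\<lambda>w. Z (B i) w * shiftD M V (zsum \<zeta> (B i)) w))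
           + (\<Sum>i\<in>J. E (\<lambda>w. real (\<zeta> i w) * (Z (A i) w - 1) * (2 * Z (B i) w - Z (A i) w - 2)
                          * shiftD M V (\<lambda>v. (\<zeta> i v, zsum \<zeta> (A i) v, zsum \<zeta> (B i) v)) w))
    in (r * q / p = E (\<lambda>w. real (V w)) \<longrightarrow>
          (\<forall>z\<ge>0. \<bar>EAg z\<bar> \<le> C * Ua) \<and> (\<forall>z>1. \<bar>EAg z\<bar> \<le> theta z * Ua))
     \<and> (r * q / p = E (\<lambda>w. real (V w)) \<and>
         r * q / p\<^sup>2 = prob_space.variance M (\<lambda>w. real (V w)) \<longrightarrow>
          (\<forall>z\<ge>0. \<bar>EAg z\<bar> \<le> C * Ub) \<and> (\<forall>z>1. \<bar>EAg z\<bar> \<le> theta z * Ub))"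
proof -
  interpret local_dependence M J \<zeta> A B
    by (intro local_dependence.intro local_dependence_axioms.intro assms)
  interpret nb_params r p
    by unfold_locales fact+
  define theta where
    "theta z = (r + 1) / z * ((1 + 1 / (1 - p)) * p powr (- (r + 2)) - p powr (- 2))" for z
  have bound: "\<bar>g_sol r p z k\<bar> \<le> 1 / p" for z k
    using g_sol_nonpos[of z k] g_sol_ge[of z k] by linarith
  have uniform: "\<bar>g_sol r p z (Suc k) - g_sol r p z k\<bar> \<le> 2 * p powr (- (r + 1)) - 1 / p" for z k
    by (rule g_sol_diff_uniform)
  have nonuniform: "\<bar>g_sol r p z (Suc k) - g_sol r p z k\<bar> \<le> theta z" if "1 < z" "0 < k" for z k
    unfolding theta_def using that by (intro g_sol_diff_nonuniform) auto
  note p = p_pos p_less_1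
  show ?thesis
    unfolding Let_def theta_def[symmetric]
    \<comment> \<open>Four goals: the first- or second-order bound with \<open>G = 1 / p\<close>,
      and \<open>K\<close> either the uniform constant or \<open>theta z\<close>.\<close>
    by (intro conjI impI allI; (elim conjE)?; rule first_order_bound second_order_bound;
      (rule p bound uniform | (rule nonuniform; assumption) | assumption))
qed

end
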